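(* For every $n\ge 3$ there are a constant $C_n>0$, a number $R_0>0$, and non-zero real-valued harmonic functions $u_R$ on $\mathbb{R}^n$, one for each real number $R\ge R_0$, such that $u_R(0)=0$, $$\mathcal{N}_R:=\log_2\frac{\sup_{B_1}|u_R|}{\sup_{B_{1/2}}|u_R|}\longrightarrow\infty\qquad\text{as }R\to\infty,$$ and, for all $R\ge R_0$, $$\mathcal{H}^n\bigl(\{u_R>0\}\cap B_{\frac12}\bigr)\le C_n\bigl(\log(1+\mathcal{N}_R)\bigr)^{1-n}.$$
   Context: $B_r=B(0,r)\subset\mathbb{R}^n$ is the open Euclidean ball of radius $r$ centered at the origin, $\mathcal{H}^n$ is $n$-dimensional Hausdorff (Lebesgue) measure, and $\log$ is the natural logarithm. *)

theory Defs
  imports "HOL-Analysis.Analysis"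
begin

text \<open>A real-valued function is harmonic on an open set if it is twice continuously
  differentiable there and its Laplacian vanishes. Here \<open>H x i j\<close> is the second derivative of
  \<open>u\<close> at \<open>x\<close> in the directions \<open>i\<close> and \<open>j\<close>, so the sum is the sum of the pure second partial
  derivatives with respect to the orthonormal coordinates.\<close>

definition harmonic_on :: "('a::euclidean_space \<Rightarrow> real) \<Rightarrow> 'a set \<Rightarrow> bool"
    (infix \<open>harmonic'_on\<close> 50) where
  "u harmonic_on S \<longleftrightarrow> open S \<and>
    (\<exists>(D :: 'a \<Rightarrow> 'a \<Rightarrow>\<^sub>L real) (H :: 'a \<Rightarrow> 'a \<Rightarrow>\<^sub>L 'a \<Rightarrow>\<^sub>L real).
      (\<forall>x\<in>S. (u has_derivative blinfun_apply (D x)) (at x)) \<and>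
      (\<forall>x\<in>S. (D has_derivative blinfun_apply (H x)) (at x)) \<and>
      continuous_on S H \<and>
      (\<forall>x\<in>S. (\<Sum>i\<in>Basis. blinfun_apply (blinfun_apply (H x) i) i) = 0))"

text \<open>The doubling index. Both suprema are finite for continuous \<open>u\<close>; for a non-zero harmonic
  \<open>u\<close> on the whole space the denominator is positive by unique continuation.\<close>

definition doubling_index :: "('a::euclidean_space \<Rightarrow> real) \<Rightarrow> real" where
  "doubling_index u =
    log 2 ((SUP x\<in>ball 0 1. \<bar>u x\<bar>) / (SUP x\<in>ball 0 (1/2). \<bar>u x\<bar>))"

end

theory Submission
  imports Defs "HOL-Complex_Analysis.Complex_Analysis" "HOL-Real_Asymp.Real_Asymp"
begin

text \<open>
  A higher-dimensional Mittag-Leffler function. Fix a coordinate direction \<open>e\<close> and write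
  \<open>\<rho>\<close> for the distance of \<open>x\<close> from the axis \<open>\<real> e\<close>. For complex \<open>z\<close> the complexified Newton
  potential \<open>((z - x \<bullet> e)\<^sup>2 + \<rho>\<^sup>2) powr (1 - n / 2)\<close> of the point \<open>z e\<close> is harmonic in \<open>x\<close>.
  Integrate it against \<open>exp (exp z)\<close>, which equals \<open>exp (- exp s)\<close> on the lines \<open>s \<plusminus> \<i> \<pi>\<close>, along the
  boundary of the half strip \<open>Re z > b\<close>, \<open>\<bar>Im z\<bar> < \<pi>\<close>. By Cauchy's theorem the result does not depend on
  \<open>b > x \<bullet> e\<close>, so it is a harmonic function \<open>V\<close> on the whole space. If \<open>\<rho> > \<pi>\<close> the singularities
  \<open>x \<bullet> e \<plusminus> \<i> \<rho>\<close> lie outside the strip and \<open>b\<close> may be moved past \<open>x \<bullet> e\<close> to \<open>-1\<close>; hence \<open>V\<close> is bounded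
  off a tube around the axis. On the axis itself the same move picks up a residue, a derivative
  of order \<open>n - 3\<close> of \<open>exp (exp z)\<close>, so \<open>V\<close> grows doubly exponentially there, and no faster elsewhere.
  For a point \<open>p\<close> of the axis at which \<open>V\<close> exceeds its bound off the tube, take
  \<open>u\<^sub>R x = V (R x + p) - V p\<close>: it is positive only in a tube of radius of order \<open>1 / R\<close>, and
  the logarithm of its doubling index is at most of order \<open>R\<close>.
\<close>

subsection \<open>Harmonic functions and parameter integrals\<close>

text \<open>Parameter integrals are differentiated one real coordinate at a time, so harmonicity is
  reduced to scalar first partials \<open>d i\<close> and second partials \<open>h i j\<close>; the
  operator-valued derivatives are finite sums built from them.\<close>

lemma harmonic_onI_partials:
  fixes u :: "'a::euclidean_space \<Rightarrow> real"
  assumes S: "open S"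
    and u: "\<And>x. x \<in> S \<Longrightarrow> (u has_derivative (\<lambda>y. \<Sum>i\<in>Basis. (y \<bullet> i) * d i x)) (at x)"
    and d: "\<And>i x. i \<in> Basis \<Longrightarrow> x \<in> S \<Longrightarrow>
      (d i has_derivative (\<lambda>y. \<Sum>j\<in>Basis. (y \<bullet> j) * h i j x)) (at x)"
    and h: "\<And>i j. i \<in> Basis \<Longrightarrow> j \<in> Basis \<Longrightarrow> continuous_on S (h i j)"
    and lap: "\<And>x. x \<in> S \<Longrightarrow> (\<Sum>i\<in>Basis. h i i x) = 0"
  shows "u harmonic_on S"
proof -
  define D where "D x = (\<Sum>i\<in>Basis. d i x *\<^sub>R blinfun_inner_left i)" for x
  \<comment> \<open>Writing the Hessian as a sum of composed bounded linear maps lets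
    differentiability and continuity be inherited from the scalars \<open>h i j\<close>.\<close>
  define H where "H x = (\<Sum>i\<in>Basis. blinfun_scaleR_left (blinfun_inner_left i) o\<^sub>L
      (\<Sum>j\<in>Basis. h i j x *\<^sub>R blinfun_inner_left j))" for x :: 'a
  have D_app: "blinfun_apply (D x) y = (\<Sum>i\<in>Basis. (y \<bullet> i) * d i x)" for x y
    by (simp add: D_def blinfun.sum_left blinfun.scaleR_left inner_commute mult.commute)
  have H_app: "blinfun_apply (H x) y =
      (\<Sum>i\<in>Basis. (\<Sum>j\<in>Basis. (y \<bullet> j) * h i j x) *\<^sub>R blinfun_inner_left i)" for x y
    by (simp add: H_def blinfun.sum_left blinfun.scaleR_left inner_commute mult.commute)
  have 1: "(u has_derivative blinfun_apply (D x)) (at x)" if "x \<in> S" for x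
    using u[OF that] by (simp add: D_app[abs_def])
  have 2: "(D has_derivative blinfun_apply (H x)) (at x)" if "x \<in> S" for x
    unfolding H_app[abs_def] unfolding D_def[abs_def]
    by (intro has_derivative_sum has_derivative_scaleR_left d that)
  have 3: "continuous_on S H"
    unfolding H_def[abs_def]
    by (intro continuous_on_sum bounded_bilinear.continuous_on[OF bounded_bilinear_blinfun_compose]
        continuous_intros h)
  have 4: "(\<Sum>i\<in>Basis. blinfun_apply (blinfun_apply (H x) i) i) = 0" if "x \<in> S" for x
  proof -
    have "(\<Sum>i\<in>Basis. blinfun_apply (blinfun_apply (H x) i) i) =
        (\<Sum>k\<in>Basis. \<Sum>i\<in>Basis. (\<Sum>j\<in>Basis. (k \<bullet> j) * h i j x) * (k \<bullet> i))"
      by (simp add: H_app blinfun.sum_left blinfun.scaleR_left)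
    also have "\<dots> = (\<Sum>k\<in>Basis. h k k x)"
      by (simp add: inner_Basis if_distrib if_distribR cong: if_cong)
    finally show ?thesis using lap[OF that] by simp
  qed
  show ?thesis
    unfolding harmonic_on_def using S 1 2 3 4 by blast
qed

text \<open>Differentiation under the integral sign. The mean value inequality on a ball around
  \<open>x\<close> turns the bound on the partials into a Lipschitz bound, which dominates the
  difference quotients.\<close>

lemma has_derivative_integral_dominated:
  fixes f :: "'a::euclidean_space \<Rightarrow> 'b \<Rightarrow> real"
  assumes S: "open S" "x \<in> S"
    and f: "\<And>y. y \<in> S \<Longrightarrow> integrable M (f y)"
    and deriv: "\<And>y t. y \<in> S \<Longrightarrow> t \<in> space M \<Longrightarrow>
      ((\<lambda>y. f y t) has_derivative (\<lambda>v. \<Sum>i\<in>Basis. (v \<bullet> i) * d i y t)) (at y)"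
    and dom: "\<And>i y t. i \<in> Basis \<Longrightarrow> y \<in> S \<Longrightarrow> t \<in> space M \<Longrightarrow> \<bar>d i y t\<bar> \<le> m t"
    and m: "integrable M m"
    and meas: "\<And>i. i \<in> Basis \<Longrightarrow> d i x \<in> borel_measurable M"
  shows "((\<lambda>y. \<integral>t. f y t \<partial>M) has_derivative (\<lambda>v. \<Sum>i\<in>Basis. (v \<bullet> i) * (\<integral>t. d i x t \<partial>M))) (at x)"
proof -
  obtain r where r: "r > 0" "ball x r \<subseteq> S" using S openE by blast
  have di: "integrable M (d i x)" if "i \<in> Basis" for i
    by (rule Bochner_Integration.integrable_bound[OF m meas[OF that]])
      (use dom[OF that \<open>x \<in> S\<close>] in \<open>auto intro!: AE_I2 order_trans[OF _ abs_ge_self]\<close>)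
  define N where "N = real DIM('a)"
  have lin: "\<bar>\<Sum>i\<in>Basis. (v \<bullet> i) * d i y t\<bar> \<le> N * m t * norm v"
    if "y \<in> S" "t \<in> space M" for y v t
  proof -
    have "\<bar>\<Sum>i\<in>Basis. (v \<bullet> i) * d i y t\<bar> \<le> (\<Sum>i\<in>(Basis::'a set). norm v * m t)"
      by (rule order_trans[OF sum_abs]; rule sum_mono)
        (auto simp: abs_mult intro!: mult_mono dom that Basis_le_norm)
    then show ?thesis by (simp add: N_def mult_ac)
  qed
  have lip: "\<bar>f y t - f x t\<bar> \<le> N * m t * norm (y - x)" if "y \<in> ball x r" "t \<in> space M" for y t
  proof -
    have "norm (f y t - f x t) \<le> N * m t * norm (y - x)"
    proof (rule differentiable_bound[where S = "ball x r"])
      fix z assume z: "z \<in> ball x r"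
      then have zS: "z \<in> S" using r by blast
      show "((\<lambda>y. f y t) has_derivative (\<lambda>v. \<Sum>i\<in>Basis. (v \<bullet> i) * d i z t)) (at z within ball x r)"
        by (rule has_derivative_at_withinI, rule deriv[OF zS that(2)])
      show "onorm (\<lambda>v. \<Sum>i\<in>Basis. (v \<bullet> i) * d i z t) \<le> N * m t"
        by (rule onorm_le) (use lin[OF zS that(2)] in simp)
    qed (use that r in auto)
    then show ?thesis by simp
  qed
  \<comment> \<open>The normalised remainder of the first-order expansion; differentiability of the
    integral means that its integral tends to 0.\<close>
  define q where "q y t = (f y t - f x t - (\<Sum>i\<in>Basis. ((y - x) \<bullet> i) * d i x t)) / norm (y - x)" for y t
  have q_int: "(\<integral>t. q y t \<partial>M) =
      ((\<integral>t. f y t \<partial>M) - (\<integral>t. f x t \<partial>M) - (\<Sum>i\<in>Basis. ((y - x) \<bullet> i) * (\<integral>t. d i x t \<partial>M))) / norm (y - x)"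
    if "y \<in> S" for y
    unfolding q_def using f[OF that] f[OF \<open>x \<in> S\<close>] di by simp
  have lim: "((\<lambda>y. \<integral>t. q y t \<partial>M) \<longlongrightarrow> 0) (at x)"
    unfolding tendsto_at_iff_sequentially
  proof (intro allI impI)
    fix X :: "nat \<Rightarrow> 'a" assume X: "\<forall>i. X i \<in> UNIV - {x}" "X \<longlonglongrightarrow> x"
    have ev: "eventually (\<lambda>k. X k \<in> ball x r) sequentially"
      using X(2) r(1) by (auto simp: tendsto_iff dist_commute)
    then obtain K where K: "\<And>k. k \<ge> K \<Longrightarrow> X k \<in> ball x r"
      unfolding eventually_sequentially by blast
    \<comment> \<open>Shifting by \<open>K\<close> puts every term of the sequence inside the ball
      where the Lipschitz bound holds. The majorant is one \<open>N * m\<close> for the increment of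
      \<open>f\<close> plus one for the linear term.\<close>
    have "(\<lambda>k. \<integral>t. q (X (k + K)) t \<partial>M) \<longlonglongrightarrow> (\<integral>t. 0 \<partial>M)"
    proof (rule integral_dominated_convergence[where w = "\<lambda>t. 2 * N * m t"])
      show "integrable M (\<lambda>t. 2 * N * m t)" using m by simp
      show "q (X (k + K)) \<in> borel_measurable M" for k
      proof -
        have "X (k + K) \<in> S" using K[of "k + K"] r by auto
        then show ?thesis unfolding q_def[abs_def]
          using borel_measurable_integrable[OF f] \<open>x \<in> S\<close> meas by measurable
      qed
      show "AE t in M. (\<lambda>k. q (X (k + K)) t) \<longlonglongrightarrow> 0"
      proof (rule AE_I2)
        fix t assume t: "t \<in> space M"
        have "((\<lambda>y. q y t) \<longlongrightarrow> 0) (at x)"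
          using deriv[OF \<open>x \<in> S\<close> t] unfolding has_derivative_at_within q_def
          by (simp add: divide_inverse mult.commute)
        then have "(\<lambda>k. q (X k) t) \<longlonglongrightarrow> 0"
          using X unfolding tendsto_at_iff_sequentially by (auto simp: o_def)
        then show "(\<lambda>k. q (X (k + K)) t) \<longlonglongrightarrow> 0" by (rule LIMSEQ_ignore_initial_segment)
      qed
      show "AE t in M. norm (q (X (k + K)) t) \<le> 2 * N * m t" for k
      proof (rule AE_I2)
        fix t assume t: "t \<in> space M"
        have nz: "norm (X (k + K) - x) > 0" using X by auto
        have "\<bar>f (X (k + K)) t - f x t - (\<Sum>i\<in>Basis. ((X (k + K) - x) \<bullet> i) * d i x t)\<bar>
            \<le> 2 * N * m t * norm (X (k + K) - x)"
          using lip[OF K[of "k + K"] t] lin[OF \<open>x \<in> S\<close> t, of "X (k + K) - x"] by simp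
        then show "norm (q (X (k + K)) t) \<le> 2 * N * m t"
          using nz by (simp add: q_def divide_simps)
      qed
    qed simp
    then show "((\<lambda>y. \<integral>t. q y t \<partial>M) \<circ> X) \<longlonglongrightarrow> 0"
      unfolding o_def using LIMSEQ_offset[of "\<lambda>k. \<integral>t. q (X k) t \<partial>M" K 0] by simp
  qed
  have bl: "bounded_linear (\<lambda>v. \<Sum>i\<in>Basis. (v \<bullet> i) * (\<integral>t. d i x t \<partial>M))"
    by (intro bounded_linear_intros)
  have "((\<lambda>y. ((\<integral>t. f y t \<partial>M) - (\<integral>t. f x t \<partial>M) -
      (\<Sum>i\<in>Basis. ((y - x) \<bullet> i) * (\<integral>t. d i x t \<partial>M))) / norm (y - x)) \<longlongrightarrow> 0) (at x)"
    by (rule Lim_transform_within_open[OF lim S]) (simp add: q_int)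
  then show ?thesis
    unfolding has_derivative_at_within using bl by (simp add: divide_inverse mult.commute)
qed

lemma harmonic_on_add:
  fixes u v :: "'a::euclidean_space \<Rightarrow> real"
  assumes "u harmonic_on S" "v harmonic_on S"
  shows "(\<lambda>x. u x + v x) harmonic_on S"
proof -
  from assms(1) obtain D H where 1: "open S" "\<forall>x\<in>S. (u has_derivative blinfun_apply (D x)) (at x)"
      "\<forall>x\<in>S. (D has_derivative blinfun_apply (H x)) (at x)" "continuous_on S H"
      "\<forall>x\<in>S. (\<Sum>i\<in>Basis. blinfun_apply (blinfun_apply (H x) i) i) = 0"
    unfolding harmonic_on_def by blast
  from assms(2) obtain D' H' where 2: "\<forall>x\<in>S. (v has_derivative blinfun_apply (D' x)) (at x)"
      "\<forall>x\<in>S. (D' has_derivative blinfun_apply (H' x)) (at x)" "continuous_on S H'"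
      "\<forall>x\<in>S. (\<Sum>i\<in>Basis. blinfun_apply (blinfun_apply (H' x) i) i) = 0"
    unfolding harmonic_on_def by blast
  show ?thesis
    unfolding harmonic_on_def
  proof (intro conjI exI ballI)
    show "((\<lambda>x. u x + v x) has_derivative blinfun_apply (D x + D' x)) (at x)" if "x \<in> S" for x
      using has_derivative_add[OF 1(2)[rule_format, OF that] 2(1)[rule_format, OF that]]
      by (simp add: plus_blinfun.rep_eq)
    show "((\<lambda>x. D x + D' x) has_derivative blinfun_apply (H x + H' x)) (at x)" if "x \<in> S" for x
      using has_derivative_add[OF 1(3)[rule_format, OF that] 2(2)[rule_format, OF that]]
      by (simp add: plus_blinfun.rep_eq)
    show "continuous_on S (\<lambda>x. H x + H' x)" by (intro continuous_intros 1 2)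
  qed (use 1 2 in \<open>auto simp: plus_blinfun.rep_eq sum.distrib\<close>)
qed

lemma harmonic_on_continuous_on:
  assumes "u harmonic_on S"
  shows "continuous_on S u"
proof -
  obtain D where "\<forall>x\<in>S. (u has_derivative blinfun_apply (D x)) (at x)"
    using assms unfolding harmonic_on_def by blast
  then show ?thesis
    by (meson continuous_at_imp_continuous_on has_derivative_continuous)
qed

lemma harmonic_on_affine:
  fixes u :: "'a::euclidean_space \<Rightarrow> real"
  assumes "u harmonic_on UNIV"
  shows "(\<lambda>x. u (r *\<^sub>R x + p) - c) harmonic_on UNIV"
proof -
  from assms obtain D H where 1: "\<And>x. (u has_derivative blinfun_apply (D x)) (at x)"
      "\<And>x. (D has_derivative blinfun_apply (H x)) (at x)" "continuous_on UNIV H"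
      "\<And>x. (\<Sum>i\<in>Basis. blinfun_apply (blinfun_apply (H x) i) i) = 0"
    unfolding harmonic_on_def by auto
  have aff: "((\<lambda>x. r *\<^sub>R x + p) has_derivative (\<lambda>y. r *\<^sub>R y)) (at x)" for x :: 'a
    by (auto intro!: derivative_eq_intros)
  have D1: "((\<lambda>x. u (r *\<^sub>R x + p) - c) has_derivative blinfun_apply (r *\<^sub>R D (r *\<^sub>R x + p))) (at x)" for x
    using has_derivative_diff[OF has_derivative_compose[OF aff 1(1)] has_derivative_const]
    by (simp add: blinfun.scaleR_left blinfun.scaleR_right scaleR_blinfun.rep_eq)
  have H1: "((\<lambda>x. r *\<^sub>R D (r *\<^sub>R x + p)) has_derivative
      blinfun_apply ((r * r) *\<^sub>R H (r *\<^sub>R x + p))) (at x)" for x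
    by (rule has_derivative_eq_rhs[OF has_derivative_scaleR_right[OF has_derivative_compose[OF aff 1(2)]]])
      (simp add: fun_eq_iff blinfun.scaleR_left blinfun.scaleR_right)
  have C1: "continuous_on UNIV (\<lambda>x. (r * r) *\<^sub>R H (r *\<^sub>R x + p))"
    by (intro continuous_intros continuous_on_compose2[OF 1(3)]) auto
  show ?thesis
    unfolding harmonic_on_def
    by (intro conjI exI[of _ "\<lambda>x. r *\<^sub>R D (r *\<^sub>R x + p)"]
        exI[of _ "\<lambda>x. (r * r) *\<^sub>R H (r *\<^sub>R x + p)"] ballI D1 H1 C1)
      (simp_all add: blinfun.scaleR_left 1(4) flip: sum_distrib_left)
qed

text \<open>Derivative witnesses chosen on different neighbourhoods have to be glued. Frechet
  derivatives are unique, so \<open>frechet_derivative\<close> gives global witnesses that agree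
  with every local choice.\<close>

lemma harmonic_on_locally:
  fixes u :: "'a::euclidean_space \<Rightarrow> real"
  assumes "open S"
    and loc: "\<And>x. x \<in> S \<Longrightarrow> \<exists>T v. x \<in> T \<and> v harmonic_on T \<and> (\<forall>y\<in>T. u y = v y)"
  shows "u harmonic_on S"
proof -
  define D where "D x = Blinfun (frechet_derivative u (at x))" for x
  define H where "H x = Blinfun (frechet_derivative D (at x))" for x
  have local: "(u has_derivative blinfun_apply (D x)) (at x) \<and>
      (D has_derivative blinfun_apply (H x)) (at x) \<and> isCont H x \<and>
      (\<Sum>i\<in>Basis. blinfun_apply (blinfun_apply (H x) i) i) = 0" if xS: "x \<in> S" for x
  proof -
    obtain T v where T: "x \<in> T" "v harmonic_on T" "\<And>y. y \<in> T \<Longrightarrow> u y = v y"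
      using loc[OF xS] by blast
    then obtain D' H' where 1: "open T" "\<And>x. x \<in> T \<Longrightarrow> (v has_derivative blinfun_apply (D' x)) (at x)"
      "\<And>x. x \<in> T \<Longrightarrow> (D' has_derivative blinfun_apply (H' x)) (at x)" "continuous_on T H'"
      "\<And>x. x \<in> T \<Longrightarrow> (\<Sum>i\<in>Basis. blinfun_apply (blinfun_apply (H' x) i) i) = 0"
      unfolding harmonic_on_def by blast
    have ud: "(u has_derivative blinfun_apply (D' y)) (at y)" if "y \<in> T" for y
      by (rule has_derivative_transform_within_open[OF 1(2)[OF that] 1(1) that]) (simp add: T)
    have D: "D y = D' y" if "y \<in> T" for y
      using frechet_derivative_at[OF ud[OF that], symmetric] by (simp add: D_def blinfun_apply_inverse)
    have Dd: "(D has_derivative blinfun_apply (H' y)) (at y)" if "y \<in> T" for y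
      by (rule has_derivative_transform_within_open[OF 1(3)[OF that] 1(1) that]) (simp add: D)
    have H: "H y = H' y" if "y \<in> T" for y
      using frechet_derivative_at[OF Dd[OF that], symmetric] by (simp add: H_def blinfun_apply_inverse)
    have "continuous_on T H" using 1(4) H by (simp cong: continuous_on_cong)
    then have "isCont H x" using T(1) 1(1) by (simp add: continuous_on_eq_continuous_at)
    then show ?thesis using ud Dd D H T(1) 1(5) by auto
  qed
  show ?thesis
    unfolding harmonic_on_def using local \<open>open S\<close>
    by (intro conjI exI[of _ D] exI[of _ H]) (auto intro!: continuous_at_imp_continuous_on)
qed

subsection \<open>Complexified Newton potentials\<close>

text \<open>The analytic continuation in \<open>z\<close> of the squared distance between \<open>x\<close> and \<open>z e\<close>.\<close>

definition sqdist :: "'a::euclidean_space \<Rightarrow> 'a \<Rightarrow> complex \<Rightarrow> complex" where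
  "sqdist e x z = z\<^sup>2 - 2 * z * of_real (x \<bullet> e) + of_real (x \<bullet> x)"

text \<open>Here \<open>q\<close> is the distance from \<open>x\<close> to the axis, and the zeros
  \<open>x \<bullet> e \<plusminus> \<i> q\<close> are the branch points of the kernel.
  Cauchy-Schwarz makes the radicand nonnegative.\<close>

lemma sqdist_factor:
  fixes e x :: "'a::euclidean_space"
  defines "q \<equiv> sqrt (x \<bullet> x - (x \<bullet> e)\<^sup>2)"
  assumes "e \<in> Basis"
  shows "sqdist e x z = (z - of_real (x \<bullet> e) - \<i> * of_real q) * (z - of_real (x \<bullet> e) + \<i> * of_real q)"
proof -
  have "(x \<bullet> e)\<^sup>2 \<le> x \<bullet> x"
    using Cauchy_Schwarz_ineq[of x e] assms by (simp add: power2_eq_square)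
  then have "q\<^sup>2 = x \<bullet> x - (x \<bullet> e)\<^sup>2" by (simp add: q_def)
  then have "(complex_of_real q)\<^sup>2 = of_real (x \<bullet> x) - of_real (x \<bullet> e) ^ 2"
    by (metis of_real_diff of_real_power)
  then show ?thesis by (simp add: sqdist_def algebra_simps power2_eq_square)
qed

text \<open>Both factors of \<open>sqdist_factor\<close> have real part
  \<open>Re z - x \<bullet> e\<close>, which bounds each modulus from below.\<close>

lemma sqdist_norm_ge:
  assumes "e \<in> Basis"
  shows "(Re z - x \<bullet> e)\<^sup>2 \<le> norm (sqdist e x z)"
proof -
  define q where "q = sqrt (x \<bullet> x - (x \<bullet> e)\<^sup>2)"
  have "\<bar>Re z - x \<bullet> e\<bar> * \<bar>Re z - x \<bullet> e\<bar> \<le>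
      norm (z - of_real (x \<bullet> e) - \<i> * of_real q) * norm (z - of_real (x \<bullet> e) + \<i> * of_real q)"
    using abs_Re_le_cmod[of "z - of_real (x \<bullet> e) - \<i> * of_real q"]
      abs_Re_le_cmod[of "z - of_real (x \<bullet> e) + \<i> * of_real q"]
    by (intro mult_mono) auto
  then show ?thesis
    by (simp add: sqdist_factor[OF assms] norm_mult q_def power2_eq_square abs_mult_self_eq)
qed

text \<open>To the right of \<open>x\<close> a vanishing imaginary part forces \<open>z\<close> to
  be real, and then the value is a genuine positive squared distance. Hence the principal power is
  holomorphic on that half plane.\<close>

lemma sqdist_slit:
  assumes "e \<in> Basis" "x \<bullet> e < Re z"
  shows "sqdist e x z \<notin> \<real>\<^sub>\<le>\<^sub>0"
proof
  assume A: "sqdist e x z \<in> \<real>\<^sub>\<le>\<^sub>0"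
  have le: "(x \<bullet> e)\<^sup>2 \<le> x \<bullet> x"
    using Cauchy_Schwarz_ineq[of x e] assms by (simp add: power2_eq_square)
  have "Im (sqdist e x z) = 2 * Im z * (Re z - x \<bullet> e)"
    by (simp add: sqdist_def power2_eq_square algebra_simps)
  with A assms have im: "Im z = 0" by (auto simp: complex_nonpos_Reals_iff)
  have "Re (sqdist e x z) = (Re z - x \<bullet> e)\<^sup>2 + (x \<bullet> x - (x \<bullet> e)\<^sup>2)"
    using im by (simp add: sqdist_def power2_eq_square algebra_simps)
  moreover have "(Re z - x \<bullet> e)\<^sup>2 > 0" using assms by simp
  ultimately have "Re (sqdist e x z) > 0" using le by linarith
  then show False using A by (auto simp: complex_nonpos_Reals_iff)
qed

lemma norm_sqdist_powr_le:
  assumes "e \<in> Basis" "\<delta> > 0" "x \<bullet> e + \<delta> \<le> Re z" "a \<le> 0"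
  shows "norm (sqdist e x z powr of_real a) \<le> \<delta> powr (2 * a)"
proof -
  have "\<delta>\<^sup>2 \<le> (Re z - x \<bullet> e)\<^sup>2" using assms by (intro power_mono) auto
  then have 1: "\<delta>\<^sup>2 \<le> norm (sqdist e x z)" using sqdist_norm_ge[OF assms(1), of z x] by linarith
  have "norm (sqdist e x z powr of_real a) = norm (sqdist e x z) powr a"
    by (simp add: norm_powr_real_powr')
  also have "\<dots> \<le> (\<delta>\<^sup>2) powr a"
    using 1 assms by (intro powr_mono2') auto
  also have "\<dots> = \<delta> powr (2 * a)"
  proof -
    have "\<delta>\<^sup>2 = \<delta> powr 2" using assms(2) by simp
    then show ?thesis by (simp only: powr_powr)
  qed
  finally show ?thesis .
qed

section \<open>Spatial derivatives of the complexified potentials\<close>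

lemma has_derivative_sqdist:
  "((\<lambda>x. sqdist e x z) has_derivative
    (\<lambda>y. \<Sum>i\<in>Basis. of_real (y \<bullet> i) * (2 * (of_real (x \<bullet> i) - z * of_real (e \<bullet> i))))) (at x)"
proof -
  have "((\<lambda>x. sqdist e x z) has_derivative
    (\<lambda>y. 2 * of_real (x \<bullet> y) - 2 * z * of_real (y \<bullet> e))) (at x)"
    unfolding sqdist_def by (auto intro!: derivative_eq_intros simp: inner_commute)
  moreover have "2 * complex_of_real (x \<bullet> y) - 2 * z * of_real (y \<bullet> e) =
      (\<Sum>i\<in>Basis. of_real (y \<bullet> i) * (2 * (of_real (x \<bullet> i) - z * of_real (e \<bullet> i))))" for y
  proof -
    have 1: "x \<bullet> y = (\<Sum>i\<in>Basis. (y \<bullet> i) * (x \<bullet> i))"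
      by (subst euclidean_inner) (simp add: mult.commute)
    have 2: "y \<bullet> e = (\<Sum>i\<in>Basis. (y \<bullet> i) * (e \<bullet> i))"
      by (subst euclidean_inner) simp
    show ?thesis unfolding 1 2
      by (simp add: sum_distrib_left algebra_simps sum_subtractf)
  qed
  ultimately show ?thesis by simp
qed

lemma has_derivative_sqdist_powr:
  assumes "sqdist e x z \<notin> \<real>\<^sub>\<le>\<^sub>0"
  shows "((\<lambda>x. sqdist e x z powr \<alpha>) has_derivative
    (\<lambda>y. \<Sum>i\<in>Basis. of_real (y \<bullet> i) *
      (2 * \<alpha> * sqdist e x z powr (\<alpha> - 1) * (of_real (x \<bullet> i) - z * of_real (e \<bullet> i))))) (at x)"
proof -
  have "((\<lambda>w. w powr \<alpha>) has_derivative (*) (\<alpha> * sqdist e x z powr (\<alpha> - 1))) (at (sqdist e x z))"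
    using has_field_derivative_powr[OF assms] by (simp add: has_field_derivative_def)
  from has_derivative_compose[OF has_derivative_sqdist this] show ?thesis
    by (rule has_derivative_eq_rhs) (simp only: sum_distrib_left mult_ac)
qed

lemma continuous_at_integral_dominated:
  fixes f :: "'a::metric_space \<Rightarrow> 'b \<Rightarrow> real"
  assumes S: "open S" "x \<in> S"
    and meas: "\<And>y. y \<in> S \<Longrightarrow> f y \<in> borel_measurable M"
    and cont: "\<And>t. t \<in> space M \<Longrightarrow> isCont (\<lambda>y. f y t) x"
    and dom: "\<And>y t. y \<in> S \<Longrightarrow> t \<in> space M \<Longrightarrow> \<bar>f y t\<bar> \<le> m t"
    and m: "integrable M m"
  shows "isCont (\<lambda>y. \<integral>t. f y t \<partial>M) x"
  unfolding continuous_at_sequentially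
proof (intro allI impI)
  fix X assume X: "X \<longlonglongrightarrow> x"
  then obtain K where K: "\<And>k. k \<ge> K \<Longrightarrow> X k \<in> S"
    using topological_tendstoD[OF X S] unfolding eventually_sequentially by blast
  have "(\<lambda>k. \<integral>t. f (X (k + K)) t \<partial>M) \<longlonglongrightarrow> (\<integral>t. f x t \<partial>M)"
  proof (rule integral_dominated_convergence[where w = m])
    show "AE t in M. (\<lambda>k. f (X (k + K)) t) \<longlonglongrightarrow> f x t"
    proof (rule AE_I2)
      fix t assume "t \<in> space M"
      from cont[OF this] X have "(\<lambda>k. f (X k) t) \<longlonglongrightarrow> f x t"
        by (simp add: continuous_at_sequentially o_def)
      then show "(\<lambda>k. f (X (k + K)) t) \<longlonglongrightarrow> f x t" by (rule LIMSEQ_ignore_initial_segment)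
    qed
    show "AE t in M. norm (f (X (k + K)) t) \<le> m t" for k
      using dom K by (auto intro!: AE_I2)
  qed (use meas K S m in auto)
  then show "((\<lambda>y. \<integral>t. f y t \<partial>M) \<circ> X) \<longlonglongrightarrow> (\<integral>t. f x t \<partial>M)"
    unfolding o_def by (rule LIMSEQ_offset)
qed

text \<open>Half the partial derivative of \<open>sqdist e x z\<close> in direction \<open>i\<close>.\<close>

definition halfgrad :: "'a::euclidean_space \<Rightarrow> 'a \<Rightarrow> 'a \<Rightarrow> complex \<Rightarrow> complex" where
  "halfgrad e i x z = of_real (x \<bullet> i) - z * of_real (e \<bullet> i)"

lemma has_derivative_Re_sqdist_powr:
  assumes "sqdist e x z \<notin> \<real>\<^sub>\<le>\<^sub>0"
  shows "((\<lambda>x. Re (c * sqdist e x z powr \<alpha>)) has_derivative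
    (\<lambda>y. \<Sum>i\<in>Basis. (y \<bullet> i) *
      Re (c * (2 * \<alpha> * sqdist e x z powr (\<alpha> - 1) * halfgrad e i x z)))) (at x)"
proof -
  have "c * (\<Sum>i\<in>Basis. of_real (y \<bullet> i) *
      (2 * \<alpha> * sqdist e x z powr (\<alpha> - 1) * (of_real (x \<bullet> i) - z * of_real (e \<bullet> i)))) =
    (\<Sum>i\<in>Basis. of_real (y \<bullet> i) *
      (c * (2 * \<alpha> * sqdist e x z powr (\<alpha> - 1) * halfgrad e i x z)))" for y
    unfolding halfgrad_def sum_distrib_left by (simp only: mult_ac)
  then show ?thesis
    by (intro has_derivative_eq_rhs[OF has_derivative_Re[OF
        has_derivative_mult_right[OF has_derivative_sqdist_powr[OF assms]]]])
      (simp add: fun_eq_iff)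
qed

lemma has_derivative_Re_sqdist_grad:
  assumes "sqdist e x z \<notin> \<real>\<^sub>\<le>\<^sub>0" "i \<in> Basis"
  shows "((\<lambda>x. Re (c * (2 * \<alpha> * sqdist e x z powr (\<alpha> - 1) * halfgrad e i x z))) has_derivative
    (\<lambda>y. \<Sum>j\<in>Basis. (y \<bullet> j) *
      Re (c * (4 * \<alpha> * (\<alpha> - 1) * sqdist e x z powr (\<alpha> - 2) * halfgrad e i x z * halfgrad e j x z
        + (if i = j then 2 * \<alpha> * sqdist e x z powr (\<alpha> - 1) else 0))))) (at x)"
proof -
  have 1: "((\<lambda>x. halfgrad e i x z) has_derivative (\<lambda>y. of_real (y \<bullet> i))) (at x)"
    unfolding halfgrad_def by (auto intro!: derivative_eq_intros)
  \<comment> \<open>Expanding with a Kronecker delta brings this term under the sum over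
    \<open>j\<close>; it becomes the diagonal part of the Hessian.\<close>
  have 2: "complex_of_real (y \<bullet> i) = (\<Sum>j\<in>Basis. of_real (y \<bullet> j) * (if i = j then 1 else 0))" for y
    using assms(2) by (simp add: if_distrib cong: if_cong)
  have a2: "\<alpha> - 1 - 1 = \<alpha> - 2" by simp
  note D = has_derivative_Re[OF has_derivative_mult_right[OF has_derivative_mult[OF
      has_derivative_mult_right[OF has_derivative_sqdist_powr[OF assms(1), of "\<alpha> - 1"], of "2 * \<alpha>"] 1]], of c]
  have "Re (c * (2 * \<alpha> * sqdist e x z powr (\<alpha> - 1) * of_real (y \<bullet> i) +
      2 * \<alpha> * (\<Sum>j\<in>Basis. of_real (y \<bullet> j) * (2 * (\<alpha> - 1) * sqdist e x z powr (\<alpha> - 1 - 1) *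
        (of_real (x \<bullet> j) - z * of_real (e \<bullet> j)))) * halfgrad e i x z)) =
      (\<Sum>j\<in>Basis. (y \<bullet> j) *
      Re (c * (4 * \<alpha> * (\<alpha> - 1) * sqdist e x z powr (\<alpha> - 2) * halfgrad e i x z * halfgrad e j x z
        + (if i = j then 2 * \<alpha> * sqdist e x z powr (\<alpha> - 1) else 0))))" (is "Re ?L = ?R") for y
  proof -
    have "?L = (\<Sum>j\<in>Basis. of_real (y \<bullet> j) *
      (c * (4 * \<alpha> * (\<alpha> - 1) * sqdist e x z powr (\<alpha> - 2) * halfgrad e i x z * halfgrad e j x z
        + (if i = j then 2 * \<alpha> * sqdist e x z powr (\<alpha> - 1) else 0))))"
      unfolding 2 a2 halfgrad_def[symmetric] sum_distrib_left sum_distrib_right sum.distrib[symmetric]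
      by (rule sum.cong) (auto simp: algebra_simps)
    then show ?thesis by simp
  qed
  then show ?thesis
    by (intro has_derivative_eq_rhs[OF D]) (simp add: fun_eq_iff)
qed

text \<open>The complex form of the eikonal identity: the gradient of the squared distance has
  square four times the squared distance. It is what makes the Laplacian of a power of
  \<open>sqdist\<close> a multiple of a single power.\<close>

lemma sum_halfgrad_square:
  assumes "e \<in> Basis"
  shows "(\<Sum>i\<in>Basis. halfgrad e i x z * halfgrad e i x z) = sqdist e x z"
proof -
  have "(\<Sum>i\<in>Basis. halfgrad e i x z * halfgrad e i x z) =
      of_real (\<Sum>i\<in>Basis. (x \<bullet> i) * (x \<bullet> i)) - 2 * z * of_real (\<Sum>i\<in>Basis. (x \<bullet> i) * (e \<bullet> i)) +
      z\<^sup>2 * of_real (\<Sum>i\<in>Basis. (e \<bullet> i) * (e \<bullet> i))"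
    by (simp add: halfgrad_def algebra_simps power2_eq_square sum.distrib sum_subtractf
        flip: sum_distrib_left)
  also have "\<dots> = sqdist e x z"
    using assms by (simp add: sqdist_def flip: euclidean_inner)
  finally show ?thesis .
qed

lemma norm_halfgrad_le:
  assumes "i \<in> Basis" "e \<in> Basis"
  shows "norm (halfgrad e i x z) \<le> norm x + norm z"
proof -
  have "norm (z * complex_of_real (e \<bullet> i)) \<le> norm z"
    using assms by (auto simp: inner_Basis)
  moreover have "norm (complex_of_real (x \<bullet> i)) \<le> norm x" using assms by (simp add: Basis_le_norm)
  ultimately show ?thesis unfolding halfgrad_def
    by (intro order_trans[OF norm_triangle_ineq4]) auto
qed

text \<open>Potentials with complex poles \<open>\<zeta> t\<close> and weights \<open>c t\<close>
  may be integrated because the poles lie to the right of the half space. Negative powers of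
  \<open>sqdist\<close> are then locally bounded, and the two factors
  \<open>1 + norm (\<zeta> t)\<close> pay for the two half gradients in a second derivative.\<close>

lemma harmonic_on_superposition:
  fixes e :: "'a::euclidean_space" and A :: "real set"
  defines "a \<equiv> 1 - real DIM('a) / 2" and "M \<equiv> restrict_space lborel A"
  assumes e: "e \<in> Basis" and dim: "DIM('a) \<ge> 2" and A: "A \<in> sets borel"
    and \<zeta>: "continuous_on A \<zeta>" "\<And>t. t \<in> A \<Longrightarrow> b \<le> Re (\<zeta> t)" and c: "continuous_on A c"
    and int: "integrable M (\<lambda>t. norm (c t) * (1 + norm (\<zeta> t))\<^sup>2)"
  shows "(\<lambda>x. \<integral>t. Re (c t * sqdist e x (\<zeta> t) powr of_real a) \<partial>M) harmonic_on {x. x \<bullet> e < b}"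
    (is "_ harmonic_on ?S")
proof -
  have spM: "space M = A" by (simp add: M_def space_restrict_space)
  have meas: "f \<in> borel_measurable M" if "continuous_on A f" for f :: "real \<Rightarrow> real"
  proof -
    have "f \<in> borel_measurable (restrict_space borel A)"
      by (rule borel_measurable_continuous_on_restrict[OF that])
    moreover have "sets M = sets (restrict_space borel A)"
      unfolding M_def by (rule sets_restrict_space_cong) simp
    ultimately show ?thesis by (simp cong: measurable_cong_sets)
  qed
  define w where "w t = norm (c t) * (1 + norm (\<zeta> t))\<^sup>2" for t
  define f where "f x t = Re (c t * sqdist e x (\<zeta> t) powr of_real a)" for x t
  define d where "d i x t = Re (c t * (2 * of_real a * sqdist e x (\<zeta> t) powr (of_real a - 1) *
      halfgrad e i x (\<zeta> t)))" for i x t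
  define h where "h i j x t = Re (c t * (4 * of_real a * (of_real a - 1) *
      sqdist e x (\<zeta> t) powr (of_real a - 2) * halfgrad e i x (\<zeta> t) * halfgrad e j x (\<zeta> t)
      + (if i = j then 2 * of_real a * sqdist e x (\<zeta> t) powr (of_real a - 1) else 0)))" for i j x t
  have a: "a \<le> 0" using dim by (simp add: a_def)
  have slit: "sqdist e x (\<zeta> t) \<notin> \<real>\<^sub>\<le>\<^sub>0" if "x \<in> ?S" "t \<in> A" for x t
    using sqdist_slit[OF e, of x "\<zeta> t"] \<zeta>(2)[OF that(2)] that(1) by simp
  have cont_q: "continuous_on A (\<lambda>t. sqdist e x (\<zeta> t) powr \<alpha>)" if "x \<in> ?S" for x \<alpha>
  proof (rule continuous_on_compose2[where f = "\<lambda>t. sqdist e x (\<zeta> t)" and t = "- \<real>\<^sub>\<le>\<^sub>0"])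
    show "continuous_on (- \<real>\<^sub>\<le>\<^sub>0) (\<lambda>w. w powr \<alpha>)"
      by (intro continuous_at_imp_continuous_on ballI isCont_powr_complex) auto
    show "continuous_on A (\<lambda>t. sqdist e x (\<zeta> t))"
      unfolding sqdist_def by (intro continuous_intros \<zeta>(1))
  qed (use slit[OF that] in auto)
  have cont_p: "continuous_on A (\<lambda>t. halfgrad e i x (\<zeta> t))" for i x
    unfolding halfgrad_def by (intro continuous_intros \<zeta>(1))
  have f_meas: "f x \<in> borel_measurable M" if "x \<in> ?S" for x
    unfolding f_def[abs_def] by (intro meas continuous_intros c cont_q that)
  have d_meas: "d i x \<in> borel_measurable M" if "x \<in> ?S" for i x
    unfolding d_def[abs_def] by (intro meas continuous_intros c cont_q cont_p that)
  have h_meas: "h i j x \<in> borel_measurable M" if "x \<in> ?S" for i j x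
  proof (cases "i = j")
    case True
    show ?thesis unfolding h_def[abs_def] if_P[OF True]
      by (intro meas continuous_on_Re continuous_on_mult continuous_on_add continuous_on_const
          c cont_q cont_p that)
  next
    case False
    show ?thesis unfolding h_def[abs_def] if_not_P[OF False]
      by (intro meas continuous_on_Re continuous_on_mult continuous_on_add continuous_on_const
          c cont_q cont_p that)
  qed
  have w_int: "integrable M w" using int by (simp add: w_def[abs_def])
  have loc: "\<exists>T K. open T \<and> x0 \<in> T \<and> T \<subseteq> ?S \<and> (\<forall>x\<in>T. \<forall>t\<in>A. \<bar>f x t\<bar> \<le> K * w t \<and>
      (\<forall>i\<in>Basis. \<bar>d i x t\<bar> \<le> K * w t \<and> (\<forall>j\<in>Basis. \<bar>h i j x t\<bar> \<le> K * w t)))"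
    if x0: "x0 \<in> ?S" for x0
  proof -
    \<comment> \<open>Half the gap to the bounding hyperplane: every point of the ball of radius
      \<delta> still keeps distance at least \<delta> from it.\<close>
    define \<delta> where "\<delta> = (b - x0 \<bullet> e) / 2"
    define X where "X = norm x0 + \<delta>"
    have \<delta>: "\<delta> > 0" using x0 by (simp add: \<delta>_def)
    have X: "X > 0" using \<delta> by (simp add: X_def add_nonneg_pos)
    have Tx: "x \<bullet> e + \<delta> \<le> b \<and> norm x \<le> X" if "x \<in> ball x0 \<delta>" for x
    proof -
      have n: "norm (x - x0) < \<delta>" using that by (simp add: dist_norm norm_minus_commute)
      have "\<bar>(x - x0) \<bullet> e\<bar> \<le> norm (x - x0)" by (rule Basis_le_norm[OF e])
      then have "x \<bullet> e - x0 \<bullet> e < \<delta>" using n by (simp add: inner_diff_left)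
      moreover have "norm x \<le> norm x0 + norm (x - x0)" using norm_triangle_ineq[of x0 "x - x0"] by simp
      ultimately show ?thesis using n by (simp add: X_def \<delta>_def field_simps)
    qed
    \<comment> \<open>The sum of the separate constants for the potential, its gradient and its
      Hessian, so that one multiple of \<open>w\<close> dominates all three.\<close>
    define K where "K = \<delta> powr (2 * a) + 2 * \<bar>a\<bar> * \<delta> powr (2 * (a - 1)) * (X + 1) +
        (4 * \<bar>a * (a - 1)\<bar> * \<delta> powr (2 * (a - 2)) * (X + 1)\<^sup>2 + 2 * \<bar>a\<bar> * \<delta> powr (2 * (a - 1)))"
    have main: "\<bar>f x t\<bar> \<le> K * w t \<and>
      (\<forall>i\<in>Basis. \<bar>d i x t\<bar> \<le> K * w t \<and> (\<forall>j\<in>Basis. \<bar>h i j x t\<bar> \<le> K * w t))"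
      if x: "x \<in> ball x0 \<delta>" and t: "t \<in> A" for x t
    proof -
      define Z where "Z = 1 + norm (\<zeta> t)"
      have Z: "Z \<ge> 1" by (simp add: Z_def)
      have wZ: "w t = norm (c t) * Z\<^sup>2" by (simp add: w_def Z_def)
      have ZZ: "Z \<le> Z\<^sup>2" "1 \<le> Z\<^sup>2" using Z by (simp_all add: power2_eq_square mult_ge1_I)
      have q: "norm (sqdist e x (\<zeta> t) powr of_real \<alpha>) \<le> \<delta> powr (2 * \<alpha>)" if "\<alpha> \<le> 0" for \<alpha>
        using norm_sqdist_powr_le[OF e \<delta> _ that, of x "\<zeta> t"] Tx[OF x] \<zeta>(2)[OF t] by simp
      have q0: "norm (sqdist e x (\<zeta> t) powr of_real a) \<le> \<delta> powr (2 * a)" using q[OF a] .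
      have q1: "norm (sqdist e x (\<zeta> t) powr (of_real a - 1)) \<le> \<delta> powr (2 * (a - 1))"
        using q[of "a - 1"] a by simp
      have q2: "norm (sqdist e x (\<zeta> t) powr (of_real a - 2)) \<le> \<delta> powr (2 * (a - 2))"
        using q[of "a - 2"] a by simp
      have p: "norm (halfgrad e i x (\<zeta> t)) \<le> (X + 1) * Z" if "i \<in> Basis" for i
      proof -
        have "norm (halfgrad e i x (\<zeta> t)) \<le> X + norm (\<zeta> t)"
          using norm_halfgrad_le[OF that e, of x "\<zeta> t"] Tx[OF x] by simp
        also have "\<dots> \<le> (X + 1) * Z" using X by (simp add: Z_def algebra_simps)
        finally show ?thesis .
      qed
      have cK: "norm (c t) * B \<le> K * w t" if "B \<le> K * Z\<^sup>2" for B
        using mult_left_mono[OF that, of "norm (c t)"] by (simp add: wZ algebra_simps)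
      have K1: "\<delta> powr (2 * a) \<le> K" "2 * \<bar>a\<bar> * \<delta> powr (2 * (a - 1)) * (X + 1) \<le> K"
        "4 * \<bar>a * (a - 1)\<bar> * \<delta> powr (2 * (a - 2)) * (X + 1)\<^sup>2 + 2 * \<bar>a\<bar> * \<delta> powr (2 * (a - 1)) \<le> K"
        using X by (auto simp: K_def)
      have K0: "K \<ge> 0" using K1(1) powr_ge_zero[of \<delta> "2 * a"] by linarith
      have "\<bar>f x t\<bar> \<le> norm (c t) * norm (sqdist e x (\<zeta> t) powr of_real a)"
        unfolding f_def by (metis abs_Re_le_cmod norm_mult)
      also have "\<dots> \<le> K * w t"
      proof (rule cK)
        have "norm (sqdist e x (\<zeta> t) powr of_real a) \<le> K" using q0 K1(1) by linarith
        also have "K \<le> K * Z\<^sup>2" using K0 ZZ mult_left_mono[of 1 "Z\<^sup>2" K] by simp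
        finally show "norm (sqdist e x (\<zeta> t) powr of_real a) \<le> K * Z\<^sup>2" .
      qed
      finally have 1: "\<bar>f x t\<bar> \<le> K * w t" .
      have 2: "\<bar>d i x t\<bar> \<le> K * w t" if i: "i \<in> Basis" for i
      proof -
        have "\<bar>d i x t\<bar> \<le> norm (c t) * norm (2 * of_real a * sqdist e x (\<zeta> t) powr (of_real a - 1) *
            halfgrad e i x (\<zeta> t))"
          unfolding d_def by (metis abs_Re_le_cmod norm_mult)
        also have "\<dots> \<le> K * w t"
        proof (rule cK)
          have "norm (2 * of_real a * sqdist e x (\<zeta> t) powr (of_real a - 1) * halfgrad e i x (\<zeta> t)) =
              2 * \<bar>a\<bar> * norm (sqdist e x (\<zeta> t) powr (of_real a - 1)) * norm (halfgrad e i x (\<zeta> t))"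
            by (simp add: norm_mult)
          also have "\<dots> \<le> 2 * \<bar>a\<bar> * \<delta> powr (2 * (a - 1)) * ((X + 1) * Z)"
            by (intro mult_mono q1 p i) auto
          also have "\<dots> \<le> K * Z"
            using mult_right_mono[OF K1(2), of Z] Z by (simp add: mult.assoc)
          also have "\<dots> \<le> K * Z\<^sup>2" by (rule mult_left_mono[OF ZZ(1) K0])
          finally show "norm (2 * of_real a * sqdist e x (\<zeta> t) powr (of_real a - 1) *
            halfgrad e i x (\<zeta> t)) \<le> K * Z\<^sup>2" .
        qed
        finally show ?thesis .
      qed
      have 3: "\<bar>h i j x t\<bar> \<le> K * w t" if i: "i \<in> Basis" and j: "j \<in> Basis" for i j
      proof -
        let ?I = "if i = j then 2 * of_real a * sqdist e x (\<zeta> t) powr (of_real a - 1) else 0"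
        let ?J = "4 * of_real a * (of_real a - 1) *
            sqdist e x (\<zeta> t) powr (of_real a - 2) * halfgrad e i x (\<zeta> t) * halfgrad e j x (\<zeta> t)"
        have "\<bar>h i j x t\<bar> \<le> norm (c t) * norm (?J + ?I)"
          unfolding h_def by (metis abs_Re_le_cmod norm_mult)
        also have "\<dots> \<le> K * w t"
        proof (rule cK)
          have na: "norm (complex_of_real a - 1) = \<bar>a - 1\<bar>"
            by (metis norm_of_real of_real_1 of_real_diff)
          have "norm ?J = 4 * \<bar>a * (a - 1)\<bar> * norm (sqdist e x (\<zeta> t) powr (of_real a - 2)) *
              norm (halfgrad e i x (\<zeta> t)) * norm (halfgrad e j x (\<zeta> t))"
            by (simp add: norm_mult na abs_mult)
          also have "\<dots> \<le> 4 * \<bar>a * (a - 1)\<bar> * \<delta> powr (2 * (a - 2)) * ((X + 1) * Z) * ((X + 1) * Z)"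
            using X Z by (intro mult_mono q2 p i j) auto
          also have "\<dots> = 4 * \<bar>a * (a - 1)\<bar> * \<delta> powr (2 * (a - 2)) * (X + 1)\<^sup>2 * Z\<^sup>2"
            by (simp add: power2_eq_square)
          finally have J: "norm ?J \<le> 4 * \<bar>a * (a - 1)\<bar> * \<delta> powr (2 * (a - 2)) * (X + 1)\<^sup>2 * Z\<^sup>2" .
          have "norm ?I \<le> 2 * \<bar>a\<bar> * norm (sqdist e x (\<zeta> t) powr (of_real a - 1))"
            by (simp add: norm_mult)
          also have "\<dots> \<le> 2 * \<bar>a\<bar> * \<delta> powr (2 * (a - 1)) * 1"
            using q1 by (auto intro!: mult_left_mono)
          also have "\<dots> \<le> 2 * \<bar>a\<bar> * \<delta> powr (2 * (a - 1)) * Z\<^sup>2"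
            by (intro mult_left_mono ZZ) auto
          finally have I: "norm ?I \<le> 2 * \<bar>a\<bar> * \<delta> powr (2 * (a - 1)) * Z\<^sup>2" .
          have "norm (?J + ?I) \<le> (4 * \<bar>a * (a - 1)\<bar> * \<delta> powr (2 * (a - 2)) * (X + 1)\<^sup>2 +
              2 * \<bar>a\<bar> * \<delta> powr (2 * (a - 1))) * Z\<^sup>2"
            using norm_triangle_ineq[of ?J ?I] I J by (simp add: distrib_right)
          also have "\<dots> \<le> K * Z\<^sup>2" by (intro mult_right_mono K1) simp
          finally show "norm (?J + ?I) \<le> K * Z\<^sup>2" .
        qed
        finally show ?thesis .
      qed
      from 1 2 3 show ?thesis by blast
    qed
    have "ball x0 \<delta> \<subseteq> ?S" using Tx \<delta> by fastforce
    with main \<delta> show ?thesis by (intro exI[of _ "ball x0 \<delta>"] exI[of _ K]) auto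
  qed
  have openS: "open ?S" by (intro open_Collect_less continuous_intros)
  show ?thesis
  proof (rule harmonic_onI_partials[where d = "\<lambda>i x. \<integral>t. d i x t \<partial>M" and h = "\<lambda>i j x. \<integral>t. h i j x t \<partial>M"])
    fix x assume x: "x \<in> ?S"
    obtain T K where T: "open T" "x \<in> T" "T \<subseteq> ?S"
      and KT: "\<forall>x\<in>T. \<forall>t\<in>A. \<bar>f x t\<bar> \<le> K * w t \<and>
        (\<forall>i\<in>Basis. \<bar>d i x t\<bar> \<le> K * w t \<and> (\<forall>j\<in>Basis. \<bar>h i j x t\<bar> \<le> K * w t))"
      using loc[OF x] by (elim exE conjE) (rule that)
    have K: "\<And>x t. x \<in> T \<Longrightarrow> t \<in> A \<Longrightarrow> \<bar>f x t\<bar> \<le> K * w t"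
      "\<And>x t i. x \<in> T \<Longrightarrow> t \<in> A \<Longrightarrow> i \<in> Basis \<Longrightarrow> \<bar>d i x t\<bar> \<le> K * w t"
      "\<And>x t i j. x \<in> T \<Longrightarrow> t \<in> A \<Longrightarrow> i \<in> Basis \<Longrightarrow> j \<in> Basis \<Longrightarrow> \<bar>h i j x t\<bar> \<le> K * w t"
      using KT by blast+
    have Kw: "integrable M (\<lambda>t. K * w t)" using w_int by simp
    have bnd: "integrable M g" if "g \<in> borel_measurable M" "\<And>t. t \<in> A \<Longrightarrow> \<bar>g t\<bar> \<le> K * w t"
      for g :: "real \<Rightarrow> real"
      by (rule Bochner_Integration.integrable_bound[OF Kw that(1)])
        (use that(2) in \<open>auto simp: spM intro!: AE_I2 order_trans[OF _ abs_ge_self]\<close>)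
    show "((\<lambda>x. \<integral>t. Re (c t * sqdist e x (\<zeta> t) powr of_real a) \<partial>M) has_derivative
      (\<lambda>y. \<Sum>i\<in>Basis. (y \<bullet> i) * (\<integral>t. d i x t \<partial>M))) (at x)"
      unfolding f_def[symmetric]
    proof (rule has_derivative_integral_dominated[OF T(1,2) _ _ _ Kw])
      show "((\<lambda>y. f y t) has_derivative (\<lambda>v. \<Sum>i\<in>Basis. v \<bullet> i * d i y t)) (at y)"
        if "y \<in> T" "t \<in> space M" for y t
        unfolding f_def d_def
        using subsetD[OF T(3) that(1)] that(2)[unfolded spM]
        by (intro has_derivative_Re_sqdist_powr slit)
      show "integrable M (f y)" if "y \<in> T" for y
        by (rule bnd[OF f_meas K(1)]) (use that subsetD[OF T(3)] in blast)+
      show "\<bar>d i y t\<bar> \<le> K * w t" if "i \<in> Basis" "y \<in> T" "t \<in> space M" for i y t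
        using K(2) that spM by blast
    qed (rule d_meas[OF x])
    show "((\<lambda>x. \<integral>t. d i x t \<partial>M) has_derivative
        (\<lambda>y. \<Sum>j\<in>Basis. (y \<bullet> j) * (\<integral>t. h i j x t \<partial>M))) (at x)" if i: "i \<in> Basis" for i
    proof (rule has_derivative_integral_dominated[OF T(1,2) _ _ _ Kw])
      show "((\<lambda>y. d i y t) has_derivative (\<lambda>v. \<Sum>j\<in>Basis. v \<bullet> j * h i j y t)) (at y)"
        if "y \<in> T" "t \<in> space M" for y t
        unfolding d_def h_def
        using subsetD[OF T(3) that(1)] that(2)[unfolded spM]
        by (intro has_derivative_Re_sqdist_grad[OF _ i] slit)
      show "integrable M (d i y)" if "y \<in> T" for y
        by (rule bnd[OF d_meas K(2)[OF _ _ i]]) (use that subsetD[OF T(3)] in blast)+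
      show "\<bar>h i j y t\<bar> \<le> K * w t" if "j \<in> Basis" "y \<in> T" "t \<in> space M" for j y t
        using K(3) that spM i by blast
    qed (rule h_meas[OF x])
    have hint: "integrable M (h i i x)" if "i \<in> Basis" for i
      using bnd[OF h_meas[OF x] K(3)[OF T(2)]] that by blast
    have "(\<Sum>i\<in>Basis. \<integral>t. h i i x t \<partial>M) = (\<integral>t. (\<Sum>i\<in>Basis. h i i x t) \<partial>M)"
      by (rule Bochner_Integration.integral_sum[symmetric]) (rule hint)
    also have "\<dots> = (\<integral>t. 0 \<partial>M)"
    proof (rule Bochner_Integration.integral_cong[OF refl])
      fix t assume "t \<in> space M"
      then have ns: "sqdist e x (\<zeta> t) \<notin> \<real>\<^sub>\<le>\<^sub>0" using slit x spM by simp
      then have nz: "sqdist e x (\<zeta> t) \<noteq> 0" by auto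
      let ?q = "sqdist e x (\<zeta> t)"
      have pw: "?q powr (of_real a - 1) = ?q powr (of_real a - 2) * ?q"
      proof -
        have "?q powr (of_real a - 2 + 1) = ?q powr (of_real a - 2) * ?q powr 1"
          by (rule powr_add)
        then show ?thesis using nz by (simp add: powr_to_1 algebra_simps)
      qed
      \<comment> \<open>The exponent is chosen for this relation: with \<open>n\<close> the
        dimension, the Laplacian has coefficient \<open>4 * a * (a - 1) + 2 * n * a\<close>, which
        vanishes for \<open>n = 2 - 2 * a\<close>.\<close>
      have dimc: "complex_of_real (real DIM('a)) = 2 - 2 * of_real a"
        by (simp add: a_def)
      have "(\<Sum>i\<in>Basis. 4 * of_real a * (of_real a - 1) * ?q powr (of_real a - 2) *
          halfgrad e i x (\<zeta> t) * halfgrad e i x (\<zeta> t) + 2 * of_real a * ?q powr (of_real a - 1)) =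
          4 * of_real a * (of_real a - 1) * ?q powr (of_real a - 2) *
          (\<Sum>i\<in>Basis. halfgrad e i x (\<zeta> t) * halfgrad e i x (\<zeta> t)) +
          complex_of_real (real DIM('a)) * (2 * of_real a * ?q powr (of_real a - 1))"
        by (simp only: sum.distrib sum_distrib_left mult.assoc sum_constant of_real_of_nat_eq)
      also have "\<dots> = 0"
        unfolding sum_halfgrad_square[OF e] dimc pw by algebra
      finally have "(\<Sum>i\<in>Basis. c t * (4 * of_real a * (of_real a - 1) * ?q powr (of_real a - 2) *
          halfgrad e i x (\<zeta> t) * halfgrad e i x (\<zeta> t) + 2 * of_real a * ?q powr (of_real a - 1))) = 0"
        by (simp only: mult_zero_right flip: sum_distrib_left)
      then show "(\<Sum>i\<in>Basis. h i i x t) = 0"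
        unfolding h_def Re_sum[symmetric] if_P[OF refl] by (simp only: zero_complex.sel)
    qed
    finally show "(\<Sum>i\<in>Basis. \<integral>t. h i i x t \<partial>M) = 0" by simp
  next
    fix i j :: 'a assume ij: "i \<in> Basis" "j \<in> Basis"
    show "continuous_on ?S (\<lambda>x. \<integral>t. h i j x t \<partial>M)"
    proof (rule continuous_at_imp_continuous_on, rule ballI)
      fix x assume x: "x \<in> ?S"
      obtain T K where T: "open T" "x \<in> T" "T \<subseteq> ?S"
        and K: "\<And>x t. x \<in> T \<Longrightarrow> t \<in> A \<Longrightarrow> \<bar>h i j x t\<bar> \<le> K * w t"
        using loc[OF x] ij by meson
      show "isCont (\<lambda>x. \<integral>t. h i j x t \<partial>M) x"
      proof (rule continuous_at_integral_dominated[OF T(1,2)])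
        show "isCont (\<lambda>y. h i j y t) x" if "t \<in> space M" for t
        proof -
          have "sqdist e x (\<zeta> t) \<notin> \<real>\<^sub>\<le>\<^sub>0" using slit x spM that by simp
          then have pw: "isCont (\<lambda>x. sqdist e x (\<zeta> t) powr \<alpha>) x" for \<alpha>
            using has_derivative_continuous[OF has_derivative_sqdist_powr] by blast
          then have "isCont (\<lambda>x. if i = j then 2 * of_real a * sqdist e x (\<zeta> t) powr (of_real a - 1) else 0) x"
            by (cases "i = j") (simp_all only: if_True if_False, auto intro!: continuous_intros)
          with pw show ?thesis unfolding h_def halfgrad_def isCont_def
            by (auto intro!: tendsto_Re tendsto_mult tendsto_add tendsto_diff tendsto_const
                tendsto_of_real tendsto_inner tendsto_ident_at simp del: minus_complex.sel times_complex.sel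
                plus_complex.sel split del: if_split)
        qed
        show "h i j y \<in> borel_measurable M" if "y \<in> T" for y
          using h_meas that T(3) by blast
        show "\<bar>h i j y t\<bar> \<le> K * w t" if "y \<in> T" "t \<in> space M" for y t
          using K that spM by blast
        show "integrable M (\<lambda>t. K * w t)" using w_int by simp
      qed
    qed
  qed (rule openS)
qed

subsection \<open>Integrals along the boundary of a half strip\<close>

lemma has_contour_integral_linepath_same_Im_iff:
  assumes "a < b"
  shows "(f has_contour_integral I) (linepath (Complex a y) (Complex b y)) \<longleftrightarrow>
    ((\<lambda>x. f (Complex x y)) has_integral I) {a..b}"
proof -
  let ?g = "\<lambda>z. f (z + \<i> * of_real y)"
  have "(f has_contour_integral I) (linepath (Complex a y) (Complex b y)) \<longleftrightarrow>
      (?g has_contour_integral I) (linepath (of_real a) (of_real b))"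
    unfolding has_contour_integral_linepath
    by (intro has_integral_cong arg_cong2[of _ _ _ _ "(*)"] arg_cong[of _ _ f])
      (auto simp: linepath_def complex_eq_iff algebra_simps)
  also have "\<dots> \<longleftrightarrow> ((\<lambda>x. ?g (of_real x)) has_integral I) {a..b}"
    using assms by (subst has_contour_integral_linepath_Reals_iff) auto
  finally show ?thesis by (simp add: Complex_eq)
qed

text \<open>The bottom side is the conjugate of the top side, so together they contribute minus
  twice the imaginary part of the top. On the vertical sides \<open>dz = \<i> dy\<close> turns the
  imaginary part into a real part.\<close>

lemma Im_contour_integral_rectpath:
  assumes "b < b'" "h > 0"
    and cont: "continuous_on (path_image (rectpath (Complex b (-h)) (Complex b' h))) f"
    and sym: "\<And>s. s \<in> {b..b'} \<Longrightarrow> f (Complex s (-h)) = cnj (f (Complex s h))"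
  shows "Im (contour_integral (rectpath (Complex b (-h)) (Complex b' h)) f) =
    integral {-h..h} (\<lambda>y. Re (f (Complex b' y))) - integral {-h..h} (\<lambda>y. Re (f (Complex b y)))
    - 2 * integral {b..b'} (\<lambda>s. Im (f (Complex s h)))"
proof -
  have img: "path_image (rectpath (Complex b (-h)) (Complex b' h)) =
      {z. Re z \<in> {b, b'} \<and> Im z \<in> {-h..h}} \<union> {z. Im z \<in> {-h, h} \<and> Re z \<in> {b..b'}}"
    using assms by (subst path_image_rectpath) auto
  have cv: "(\<lambda>y. f (Complex r y)) integrable_on {-h..h}" if "r \<in> {b, b'}" for r
    by (intro integrable_continuous_interval continuous_on_compose2[OF cont] continuous_intros)
      (use that assms(1,2) in \<open>auto simp: img\<close>)
  have ch: "(\<lambda>s. f (Complex s y)) integrable_on {b..b'}" if "y \<in> {-h, h}" for y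
    by (intro integrable_continuous_interval continuous_on_compose2[OF cont] continuous_intros)
      (use that assms(1,2) in \<open>auto simp: img\<close>)
  define Bo where "Bo = integral {b..b'} (\<lambda>s. f (Complex s (-h)))"
  define To where "To = integral {b..b'} (\<lambda>s. f (Complex s h))"
  define Le where "Le = integral {-h..h} (\<lambda>y. f (Complex b y))"
  define Ri where "Ri = integral {-h..h} (\<lambda>y. f (Complex b' y))"
  have 1: "(f has_contour_integral Bo) (linepath (Complex b (-h)) (Complex b' (-h)))"
    using assms ch[of "-h"] by (simp add: has_contour_integral_linepath_same_Im_iff Bo_def integrable_integral)
  have 2: "(f has_contour_integral (\<i> * Ri)) (linepath (Complex b' (-h)) (Complex b' h))"
    using assms cv[of b'] by (subst has_contour_integral_linepath_same_Re_iff[of _ b' _ "-h" h])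
      (auto simp: Ri_def integrable_integral)
  have "(f has_contour_integral To) (linepath (Complex b h) (Complex b' h))"
    using assms ch[of h] by (simp add: has_contour_integral_linepath_same_Im_iff To_def integrable_integral)
  from has_contour_integral_reversepath[OF _ this]
  have 3: "(f has_contour_integral (-To)) (linepath (Complex b' h) (Complex b h))" by simp
  have "(f has_contour_integral (\<i> * Le)) (linepath (Complex b (-h)) (Complex b h))"
    using assms cv[of b] by (subst has_contour_integral_linepath_same_Re_iff[of _ b _ "-h" h])
      (auto simp: Le_def integrable_integral)
  from has_contour_integral_reversepath[OF _ this]
  have 4: "(f has_contour_integral (-(\<i> * Le))) (linepath (Complex b h) (Complex b (-h)))" by simp
  have "(f has_contour_integral (Bo + (\<i> * Ri + (-To + -(\<i> * Le)))))
      (rectpath (Complex b (-h)) (Complex b' h))"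
    unfolding rectpath_def Let_def complex.sel
    by (intro has_contour_integral_join 1 2 3 4 valid_path_join valid_path_linepath) auto
  then have ci: "contour_integral (rectpath (Complex b (-h)) (Complex b' h)) f =
      Bo + (\<i> * Ri + (-To + -(\<i> * Le)))"
    by (rule contour_integral_unique)
  have "Bo = integral {b..b'} (\<lambda>s. cnj (f (Complex s h)))"
    unfolding Bo_def by (rule integral_cong) (simp add: sym)
  also have "\<dots> = cnj To" unfolding To_def by (simp add: integral_cnj)
  finally have Bo: "Bo = cnj To" .
  have "Im To = integral {b..b'} (\<lambda>s. Im (f (Complex s h)))"
    unfolding To_def using integral_linear[OF ch[of h] bounded_linear_Im] by (simp add: o_def)
  moreover have "Re Le = integral {-h..h} (\<lambda>y. Re (f (Complex b y)))"
    unfolding Le_def using integral_linear[OF cv[of b] bounded_linear_Re] by (simp add: o_def)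
  moreover have "Re Ri = integral {-h..h} (\<lambda>y. Re (f (Complex b' y)))"
    unfolding Ri_def using integral_linear[OF cv[of b'] bounded_linear_Re] by (simp add: o_def)
  ultimately show ?thesis unfolding ci Bo by simp
qed

text \<open>For \<open>f\<close> symmetric under conjugation this is \<open>1 / \<i>\<close> times the contour integral of \<open>f\<close> along the
  boundary of the half strip, run clockwise; the two horizontal sides contribute conjugate values.\<close>

definition strip_integral :: "real \<Rightarrow> (complex \<Rightarrow> complex) \<Rightarrow> real" where
  "strip_integral b f = integral {-pi..pi} (\<lambda>y. Re (f (Complex b y))) +
    2 * integral {b..} (\<lambda>s. Im (f (Complex s pi)))"

text \<open>The infinite rays beyond \<open>b'\<close> cancel, so moving the vertical side costs
  only the integral around a finite rectangle.\<close>

lemma strip_integral_diff: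
  assumes "b < b'"
    and cont: "continuous_on (path_image (rectpath (Complex b (-pi)) (Complex b' pi))) f"
    and sym: "\<And>s. s \<in> {b..b'} \<Longrightarrow> f (Complex s (-pi)) = cnj (f (Complex s pi))"
    and int: "(\<lambda>s. Im (f (Complex s pi))) integrable_on {b'..}"
  shows "strip_integral b' f - strip_integral b f =
    Im (contour_integral (rectpath (Complex b (-pi)) (Complex b' pi)) f)"
proof -
  have "(\<lambda>s. f (Complex s pi)) integrable_on {b..b'}"
    by (intro integrable_continuous_interval continuous_on_compose2[OF cont])
      (use assms(1) in \<open>auto simp: path_image_rectpath intro!: continuous_intros\<close>)
  from integrable_linear[OF this bounded_linear_Im]
  have i1: "(\<lambda>s. Im (f (Complex s pi))) integrable_on {b..b'}" by (simp add: o_def)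
  have u: "{b..} = {b..b'} \<union> {b'..}" using assms(1) by auto
  have n: "negligible ({b..b'} \<inter> {b'..})"
    using assms(1) by (intro negligible_subset[OF negligible_sing[of b']]) auto
  have "integral {b..} (\<lambda>s. Im (f (Complex s pi))) =
      integral {b..b'} (\<lambda>s. Im (f (Complex s pi))) + integral {b'..} (\<lambda>s. Im (f (Complex s pi)))"
    unfolding u by (rule integral_Un[OF i1 int n])
  then show ?thesis
    using Im_contour_integral_rectpath[OF assms(1) pi_gt_zero cont sym]
    by (simp add: strip_integral_def)
qed

text \<open>The double exponential is at most a multiple of \<open>exp (- 3 * s)\<close>, while the
  square is at most a multiple of \<open>exp (2 * s)\<close>; the product is dominated by
  \<open>exp (- s)\<close>. The quadratic weight is the one required by
  \<open>harmonic_on_superposition\<close>.\<close>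

lemma set_integrable_exp_exp_quadratic:
  assumes "c \<ge> 0"
  shows "set_integrable lborel {b..} (\<lambda>s::real. exp (- exp s) * (c + \<bar>s\<bar>)\<^sup>2)"
proof -
  define K where "K = 27 * (1 + c + \<bar>b\<bar>)\<^sup>2 * exp (- 2 * b)"
  have e1: "set_integrable lebesgue {b..} (\<lambda>s. exp (-1 * s) :: real)"
    by (intro nonnegative_absolutely_integrable_1 integrable_on_exp_minus_to_infinity) auto
  have "set_integrable lborel {b..} (\<lambda>s. exp (-1 * s) :: real)"
    using e1 unfolding set_integrable_def
    by (subst (asm) integrable_completion) simp_all
  then have e2: "set_integrable lborel {b..} (\<lambda>s. K * exp (-1 * s))" by simp
  show ?thesis
  proof (rule set_integrable_bound[OF e2])
    show "set_borel_measurable lborel {b..} (\<lambda>s. exp (- exp s) * (c + \<bar>s\<bar>)\<^sup>2)"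
      unfolding set_borel_measurable_def by measurable
    have "exp (- exp s) * (c + \<bar>s\<bar>)\<^sup>2 \<le> K * exp (-1 * s)" if "s \<ge> b" for s
    proof -
      have "exp (s - b) \<ge> 1 + (s - b)" by (rule exp_ge_add_one_self)
      moreover have "(c + \<bar>b\<bar>) * exp (s - b) \<ge> (c + \<bar>b\<bar>) * 1"
        using that assms by (intro mult_left_mono) auto
      ultimately have "c + \<bar>s\<bar> \<le> (1 + c + \<bar>b\<bar>) * exp (s - b)"
        using that by (simp add: algebra_simps)
      then have "(c + \<bar>s\<bar>)\<^sup>2 \<le> ((1 + c + \<bar>b\<bar>) * exp (s - b))\<^sup>2"
        using assms by (intro power_mono) auto
      also have "\<dots> = (1 + c + \<bar>b\<bar>)\<^sup>2 * exp (- 2 * b) * exp (2 * s)"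
      proof -
        have "(exp (s - b))\<^sup>2 = exp (- 2 * b) * exp (2 * s)"
          by (simp add: algebra_simps flip: exp_add exp_of_nat_mult)
        then show ?thesis by (simp only: power_mult_distrib mult.assoc)
      qed
      finally have 1: "(c + \<bar>s\<bar>)\<^sup>2 \<le> (1 + c + \<bar>b\<bar>)\<^sup>2 * exp (- 2 * b) * exp (2 * s)" .
      \<comment> \<open>The inequality \<open>y \<le> exp y\<close> at \<open>y = exp s / 3\<close>,
        cubed, gives the constant 27.\<close>
      have "exp s / 3 \<le> exp (exp s / 3)" using exp_ge_add_one_self[of "exp s / 3"] by linarith
      then have "(exp s / 3) ^ 3 \<le> exp (exp s / 3) ^ 3" by (intro power_mono) auto
      also have "\<dots> = exp (exp s)" by (simp flip: exp_of_nat_mult)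
      finally have "exp (3 * s) \<le> 27 * exp (exp s)"
        by (simp add: power_divide flip: exp_of_nat_mult)
      then have "exp (- exp s) \<le> 27 * exp (- (3 * s))"
        by (simp add: exp_minus field_simps)
      then have "exp (- exp s) * (c + \<bar>s\<bar>)\<^sup>2 \<le>
          27 * exp (- (3 * s)) * ((1 + c + \<bar>b\<bar>)\<^sup>2 * exp (- 2 * b) * exp (2 * s))"
        using 1 by (intro mult_mono) auto
      also have "\<dots> = K * (exp (- (3 * s)) * exp (2 * s))" by (simp add: K_def)
      also have "exp (- (3 * s)) * exp (2 * s) = exp (-1 * s)" by (simp flip: exp_add)
      finally show ?thesis .
    qed
    then show "AE s in lborel. s \<in> {b..} \<longrightarrow>
        norm (exp (- exp s) * (c + \<bar>s\<bar>)\<^sup>2) \<le> norm (K * exp (-1 * s))"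
      by (intro AE_I2 impI) (auto intro: order_trans[OF _ abs_ge_self])
  qed
qed

lemma exp_exp_Complex_pi: "exp (exp (Complex s pi)) = of_real (exp (- exp s))"
proof -
  have "exp (Complex s pi) = of_real (- exp s)"
    by (simp add: complex_eq_iff Re_exp Im_exp)
  then show ?thesis by (simp only: exp_of_real)
qed

lemma norm_exp_exp_le: "norm (exp (exp z)) \<le> exp (exp (Re z))"
proof -
  have "Re (exp z) \<le> exp (Re z)" using complex_Re_le_cmod[of "exp z"] by simp
  then show ?thesis by simp
qed

text \<open>On the ray the weight is real and doubly exponentially small, so a bounded kernel
  suffices. The factor \<open>(1 + \<bar>s\<bar>)\<^sup>2\<close>, at least 1, only serves to reuse
  the previous integrability result.\<close>

lemma tail_set_integrable:
  fixes k :: "complex \<Rightarrow> complex"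
  assumes cont: "continuous_on {b..} (\<lambda>s. k (Complex s pi))"
    and bnd: "\<And>s. s \<ge> b \<Longrightarrow> norm (k (Complex s pi)) \<le> K"
  shows "set_integrable lborel {b..} (\<lambda>s. Im (exp (exp (Complex s pi)) * k (Complex s pi)))"
proof -
  have "set_integrable lborel {b..} (\<lambda>s::real. exp (- exp s) * (1 + \<bar>s\<bar>)\<^sup>2)"
    by (rule set_integrable_exp_exp_quadratic) simp
  then have e2: "set_integrable lborel {b..} (\<lambda>s::real. K * (exp (- exp s) * (1 + \<bar>s\<bar>)\<^sup>2))" by simp
  show ?thesis
  proof (rule set_integrable_bound[OF e2])
    show "set_borel_measurable lborel {b..} (\<lambda>s. Im (exp (exp (Complex s pi)) * k (Complex s pi)))"
      unfolding exp_exp_Complex_pi set_borel_measurable_def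
      by (simp only: measurable_lborel2, intro borel_measurable_continuous_on_indicator)
        (auto intro!: continuous_intros cont)
    have "\<bar>Im (exp (exp (Complex s pi)) * k (Complex s pi))\<bar> \<le> K * (exp (- exp s) * (1 + \<bar>s\<bar>)\<^sup>2)"
      if "s \<ge> b" for s
    proof -
      have K: "K \<ge> 0" using bnd[OF that] norm_ge_zero[of "k (Complex s pi)"] by linarith
      have "\<bar>Im (exp (exp (Complex s pi)) * k (Complex s pi))\<bar> \<le> exp (- exp s) * norm (k (Complex s pi))"
        unfolding exp_exp_Complex_pi by (simp add: abs_mult abs_Im_le_cmod)
      also have "\<dots> \<le> exp (- exp s) * K" by (intro mult_left_mono bnd that) auto
      also have "\<dots> \<le> exp (- exp s) * K * (1 + \<bar>s\<bar>)\<^sup>2"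
        using mult_left_mono[of 1 "(1 + \<bar>s\<bar>)\<^sup>2" "exp (- exp s) * K"] K by (simp add: one_le_power)
      finally show ?thesis by (simp add: mult_ac)
    qed
    then show "AE s in lborel. s \<in> {b..} \<longrightarrow>
        norm (Im (exp (exp (Complex s pi)) * k (Complex s pi))) \<le> norm (K * (exp (- exp s) * (1 + \<bar>s\<bar>)\<^sup>2))"
      by (intro AE_I2 impI) (auto intro: order_trans[OF _ abs_ge_self])
  qed
qed

section \<open>Tails of the double exponential and bounds for strip integrals\<close>

definition exp_exp_tail :: "real \<Rightarrow> real" where
  "exp_exp_tail b = integral {b..} (\<lambda>s. exp (- exp s))"

lemma exp_exp_tail_integrable: "(\<lambda>s::real. exp (- exp s)) integrable_on {b..}"
proof -
  \<comment> \<open>The constant kernel \<i> turns the imaginary part into the real weight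
    itself.\<close>
  have "(\<lambda>s. Im (exp (exp (Complex s pi)) * \<i>)) integrable_on {b..}"
    by (rule set_borel_integral_eq_integral(1)[OF tail_set_integrable[where k = "\<lambda>_. \<i>" and K = 1]]) auto
  then show ?thesis unfolding exp_exp_Complex_pi by simp
qed

lemma exp_exp_tail_antimono: "b \<le> b' \<Longrightarrow> exp_exp_tail b' \<le> exp_exp_tail b"
  unfolding exp_exp_tail_def by (intro integral_subset_le exp_exp_tail_integrable) auto

text \<open>The vertical side has length \<open>2 * pi\<close> and weight at most
  \<open>exp (exp b)\<close>; the ray counts twice, with weight
  \<open>exp (- exp s)\<close>.\<close>

lemma abs_strip_integral_le:
  fixes k :: "complex \<Rightarrow> complex"
  assumes cont: "continuous_on {-pi..pi} (\<lambda>y. k (Complex b y))" "continuous_on {b..} (\<lambda>s. k (Complex s pi))"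
    and bnd: "\<And>y. \<bar>y\<bar> \<le> pi \<Longrightarrow> norm (k (Complex b y)) \<le> 1" "\<And>s. s \<ge> b \<Longrightarrow> norm (k (Complex s pi)) \<le> 1"
  shows "\<bar>strip_integral b (\<lambda>z. exp (exp z) * k z)\<bar> \<le> 2 * pi * exp (exp b) + 2 * exp_exp_tail b"
proof -
  have c1: "continuous_on {-pi..pi} (\<lambda>y. exp (exp (Complex b y)) * k (Complex b y))"
    unfolding Complex_eq by (intro continuous_intros cont(1)[unfolded Complex_eq])
  have "norm (integral {-pi..pi} (\<lambda>y. Re (exp (exp (Complex b y)) * k (Complex b y)))) \<le>
      integral {-pi..pi} (\<lambda>y. exp (exp b))"
  proof (rule integral_norm_bound_integral)
    fix y assume y: "y \<in> {-pi..pi}"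
    have "norm (exp (exp (Complex b y)) * k (Complex b y)) \<le> exp (exp b) * 1"
      unfolding norm_mult using norm_exp_exp_le[of "Complex b y"] bnd(1)[of y] y
      by (intro mult_mono) auto
    then show "norm (Re (exp (exp (Complex b y)) * k (Complex b y))) \<le> exp (exp b)"
      using abs_Re_le_cmod[of "exp (exp (Complex b y)) * k (Complex b y)"] by (simp del: times_complex.sel)
  qed (auto intro!: integrable_continuous_interval continuous_on_Re c1 simp del: times_complex.sel)
  moreover have "norm (integral {b..} (\<lambda>s. Im (exp (exp (Complex s pi)) * k (Complex s pi)))) \<le>
      integral {b..} (\<lambda>s. exp (- exp s))"
  proof (rule integral_norm_bound_integral)
    show "(\<lambda>s. Im (exp (exp (Complex s pi)) * k (Complex s pi))) integrable_on {b..}"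
      by (rule set_borel_integral_eq_integral(1)[OF tail_set_integrable[OF cont(2) bnd(2)]])
    fix s assume "s \<in> {b..}"
    then have "exp (- exp s) * norm (k (Complex s pi)) \<le> exp (- exp s) * 1"
      using bnd(2)[of s] by (intro mult_left_mono) auto
    then show "norm (Im (exp (exp (Complex s pi)) * k (Complex s pi))) \<le> exp (- exp s)"
      unfolding exp_exp_Complex_pi using abs_Im_le_cmod[of "k (Complex s pi)"]
      by (simp add: abs_mult)
  qed (rule exp_exp_tail_integrable)
  ultimately show ?thesis unfolding strip_integral_def exp_exp_tail_def by simp
qed

section \<open>Branches of the kernel and independence of the base\<close>

lemma holomorphic_on_sqdist_powr:
  assumes "\<And>z. z \<in> S \<Longrightarrow> sqdist e x z \<notin> \<real>\<^sub>\<le>\<^sub>0"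
  shows "(\<lambda>z. sqdist e x z powr \<alpha>) holomorphic_on S"
  using assms unfolding sqdist_def by (intro holomorphic_intros) auto

lemma sqdist_cnj_powr:
  assumes "sqdist e x z \<notin> \<real>\<^sub>\<le>\<^sub>0"
  shows "sqdist e x (cnj z) powr of_real a = cnj (sqdist e x z powr of_real a)"
proof -
  have "sqdist e x (cnj z) = cnj (sqdist e x z)" by (simp add: sqdist_def)
  moreover have "cnj (sqdist e x z powr of_real a) = cnj (sqdist e x z) powr cnj (of_real a)"
    using assms by (intro cnj_powr) (auto simp: complex_nonpos_Reals_iff)
  ultimately show ?thesis by simp
qed

text \<open>When \<open>x\<close> is farther from the axis than \<open>\<bar>Im z\<bar>\<close>, the
  real part of \<open>sqdist\<close> is positive for every \<open>Re z\<close>. The principal branch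
  therefore survives when the vertical side crosses \<open>Re z = x \<bullet> e\<close>.\<close>

lemma sqdist_strip:
  assumes e: "e \<in> Basis" and z: "(Im z)\<^sup>2 < x \<bullet> x - (x \<bullet> e)\<^sup>2"
  shows "x \<bullet> x - (x \<bullet> e)\<^sup>2 - (Im z)\<^sup>2 \<le> norm (sqdist e x z)" "sqdist e x z \<notin> \<real>\<^sub>\<le>\<^sub>0"
proof -
  have "Re (sqdist e x z) = (Re z - x \<bullet> e)\<^sup>2 + (x \<bullet> x - (x \<bullet> e)\<^sup>2 - (Im z)\<^sup>2)"
    by (simp add: sqdist_def power2_eq_square algebra_simps)
  then have *: "Re (sqdist e x z) \<ge> x \<bullet> x - (x \<bullet> e)\<^sup>2 - (Im z)\<^sup>2" by simp
  then show "x \<bullet> x - (x \<bullet> e)\<^sup>2 - (Im z)\<^sup>2 \<le> norm (sqdist e x z)"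
    using complex_Re_le_cmod[of "sqdist e x z"] by linarith
  show "sqdist e x z \<notin> \<real>\<^sub>\<le>\<^sub>0" using * z by (auto simp: complex_nonpos_Reals_iff)
qed

text \<open>Cauchy's theorem on the rectangle between the two vertical sides. The set
  \<open>S\<close> is kept general to cover both the half plane to the right of \<open>x\<close>
  and, far from the axis, the whole closed strip.\<close>

lemma strip_integral_indep:
  fixes k :: "complex \<Rightarrow> complex"
  assumes "b < b'" and S: "convex S" and k: "k holomorphic_on S"
    and sub: "cbox (Complex b (-pi)) (Complex b' pi) \<subseteq> S" "\<And>s. s \<ge> b' \<Longrightarrow> Complex s pi \<in> S"
    and sym: "\<And>s. s \<in> {b..b'} \<Longrightarrow> k (Complex s (-pi)) = cnj (k (Complex s pi))"
    and bnd: "\<And>s. s \<ge> b' \<Longrightarrow> norm (k (Complex s pi)) \<le> K"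
  shows "strip_integral b' (\<lambda>z. exp (exp z) * k z) = strip_integral b (\<lambda>z. exp (exp z) * k z)"
proof -
  let ?F = "\<lambda>z. exp (exp z) * k z"
  have F: "?F holomorphic_on S" by (intro holomorphic_intros k)
  have img: "path_image (rectpath (Complex b (-pi)) (Complex b' pi)) \<subseteq> S"
    using path_image_rectpath_subset_cbox[of "Complex b (-pi)" "Complex b' pi"] sub(1) assms(1) by auto
  have "(?F has_contour_integral 0) (rectpath (Complex b (-pi)) (Complex b' pi))"
    by (rule Cauchy_theorem_convex_simple[OF F S _ img]) auto
  moreover have "strip_integral b' ?F - strip_integral b ?F =
      Im (contour_integral (rectpath (Complex b (-pi)) (Complex b' pi)) ?F)"
  proof (rule strip_integral_diff[OF assms(1)])
    show "continuous_on (path_image (rectpath (Complex b (-pi)) (Complex b' pi))) ?F"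
      by (rule continuous_on_subset[OF holomorphic_on_imp_continuous_on[OF F] img])
    show "?F (Complex s (-pi)) = cnj (?F (Complex s pi))" if "s \<in> {b..b'}" for s
    proof -
      have "Complex s (-pi) = cnj (Complex s pi)" by (simp add: complex_eq_iff)
      then have "exp (exp (Complex s (-pi))) = cnj (exp (exp (Complex s pi)))"
        by (simp only: exp_cnj)
      then show ?thesis using sym[OF that] by simp
    qed
    have "continuous_on {b'..} (\<lambda>s. k (Complex s pi))"
      by (rule continuous_on_compose2[OF holomorphic_on_imp_continuous_on[OF k]])
        (auto intro!: continuous_intros sub(2))
    from tail_set_integrable[OF this bnd] show "(\<lambda>s. Im (?F (Complex s pi))) integrable_on {b'..}"
      by (intro set_borel_integral_eq_integral(1)) auto
  qed
  ultimately show ?thesis by (simp add: contour_integral_unique)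
qed

subsection \<open>The harmonic function growing only in a tube\<close>

definition kern :: "'a::euclidean_space \<Rightarrow> 'a \<Rightarrow> complex \<Rightarrow> complex" where
  "kern e x z = sqdist e x z powr of_real (1 - real DIM('a) / 2)"

text \<open>Any base to the right of \<open>x\<close> gives the same value; distance one is taken
  because there the kernel has norm at most 1. Harmonicity is not visible in this form, since the
  base moves with \<open>x\<close>.\<close>

definition tubefn :: "'a::euclidean_space \<Rightarrow> 'a \<Rightarrow> real" where
  "tubefn e x = strip_integral (x \<bullet> e + 1) (\<lambda>z. exp (exp z) * kern e x z)"

text \<open>The bound of \<open>abs_strip_integral_le\<close> at the fixed base -1, to which the
  vertical side is moved whenever an estimate must not depend on \<open>x\<close>.\<close>

definition tube_bound :: real where
  "tube_bound = 2 * pi * exp (exp (-1)) + 2 * exp_exp_tail (-1)"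

context
  fixes e :: "'a::euclidean_space"
  assumes e: "e \<in> Basis" and dim: "DIM('a) \<ge> 3"
begin

lemma holomorphic_kern_right: "kern e x holomorphic_on {z. x \<bullet> e < Re z}"
  unfolding kern_def by (intro holomorphic_on_sqdist_powr sqdist_slit e) auto

lemma norm_kern_le_1_right:
  assumes "x \<bullet> e + 1 \<le> Re z"
  shows "norm (kern e x z) \<le> 1"
  using norm_sqdist_powr_le[OF e _ assms, of "1 - real DIM('a) / 2"] dim by (simp add: kern_def)

lemma kern_cnj: "sqdist e x z \<notin> \<real>\<^sub>\<le>\<^sub>0 \<Longrightarrow> kern e x (cnj z) = cnj (kern e x z)"
  unfolding kern_def by (rule sqdist_cnj_powr)

lemma strip_integral_kern_indep:
  assumes "x \<bullet> e < b" "b < b'"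
  shows "strip_integral b' (\<lambda>z. exp (exp z) * kern e x z) =
    strip_integral b (\<lambda>z. exp (exp z) * kern e x z)"
proof (rule strip_integral_indep[OF assms(2) _ holomorphic_kern_right])
  show "convex {z. x \<bullet> e < Re z}" by (rule convex_halfspace_Re_gt)
  show "kern e x (Complex s (-pi)) = cnj (kern e x (Complex s pi))" if "s \<in> {b..b'}" for s
    using kern_cnj[OF sqdist_slit[OF e, of x "Complex s pi"]] that assms by (simp add: complex_cnj)
  show "norm (kern e x (Complex s pi)) \<le> (b' - x \<bullet> e) powr (2 * (1 - real DIM('a) / 2))" if "s \<ge> b'" for s
    unfolding kern_def using that assms dim by (intro norm_sqdist_powr_le[OF e]) auto
qed (use assms in \<open>auto simp: in_cbox_complex_iff\<close>)

text \<open>This frees the base from \<open>x\<close>: on a whole half space the function is one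
  strip integral with a fixed contour, which gives harmonicity there.\<close>

lemma tubefn_eq_strip_integral:
  assumes "x \<bullet> e < b"
  shows "tubefn e x = strip_integral b (\<lambda>z. exp (exp z) * kern e x z)"
proof -
  consider "b < x \<bullet> e + 1" | "b = x \<bullet> e + 1" | "b > x \<bullet> e + 1" by linarith
  then show ?thesis
  proof cases
    case 1 then show ?thesis unfolding tubefn_def using strip_integral_kern_indep[OF assms 1] by simp
  next
    case 3 then show ?thesis unfolding tubefn_def using strip_integral_kern_indep[OF _ 3] by simp
  qed (simp add: tubefn_def)
qed

text \<open>The base -1 already lies at distance at least one to the right of \<open>x\<close>, so
  no singularity has to be crossed.\<close>

lemma abs_tubefn_le_left:
  assumes "x \<bullet> e \<le> -2"
  shows "\<bar>tubefn e x\<bar> \<le> tube_bound"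
proof -
  have c: "continuous_on S (\<lambda>t. kern e x (\<zeta> t))"
    if "continuous_on S \<zeta>" "\<And>t. t \<in> S \<Longrightarrow> x \<bullet> e < Re (\<zeta> t)" for S and \<zeta> :: "real \<Rightarrow> complex"
    by (rule continuous_on_compose2[OF holomorphic_on_imp_continuous_on[OF holomorphic_kern_right] that(1)])
      (use that(2) in auto)
  have "\<bar>strip_integral (-1) (\<lambda>z. exp (exp z) * kern e x z)\<bar> \<le> 2 * pi * exp (exp (-1)) + 2 * exp_exp_tail (-1)"
    by (rule abs_strip_integral_le) (use assms in \<open>auto intro!: c continuous_intros norm_kern_le_1_right\<close>)
  then show ?thesis
    using tubefn_eq_strip_integral[of x "-1"] assms by (simp add: tube_bound_def)
qed

text \<open>For \<open>x \<bullet> e > -2\<close> the defining base exceeds -1, so its tail is at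
  most the one in \<open>tube_bound\<close>, and only the vertical side can be large.\<close>

lemma abs_tubefn_le:
  "\<bar>tubefn e x\<bar> \<le> tube_bound + 2 * pi * exp (exp (x \<bullet> e + 1))"
proof (cases "x \<bullet> e \<le> -2")
  case True
  then show ?thesis using abs_tubefn_le_left[OF True] by (simp add: add_increasing2)
next
  case False
  have c: "continuous_on S (\<lambda>t. kern e x (\<zeta> t))"
    if "continuous_on S \<zeta>" "\<And>t. t \<in> S \<Longrightarrow> x \<bullet> e < Re (\<zeta> t)" for S and \<zeta> :: "real \<Rightarrow> complex"
    by (rule continuous_on_compose2[OF holomorphic_on_imp_continuous_on[OF holomorphic_kern_right] that(1)])
      (use that(2) in auto)
  have "\<bar>tubefn e x\<bar> \<le> 2 * pi * exp (exp (x \<bullet> e + 1)) + 2 * exp_exp_tail (x \<bullet> e + 1)"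
    unfolding tubefn_def
    by (rule abs_strip_integral_le) (auto intro!: c continuous_intros norm_kern_le_1_right)
  moreover have "exp_exp_tail (x \<bullet> e + 1) \<le> exp_exp_tail (-1)"
    using False by (intro exp_exp_tail_antimono) auto
  moreover have "2 * pi * exp (exp (-1)) \<ge> 0" by simp
  ultimately show ?thesis unfolding tube_bound_def by linarith
qed

text \<open>The radius \<open>pi + 1\<close> instead of \<open>pi\<close> leaves a margin:
  \<open>(pi + 1)\<^sup>2 \<ge> pi\<^sup>2 + 1\<close> gives
  \<open>norm (sqdist e x z) \<ge> 1\<close> on the closed strip, so the kernel stays bounded by 1
  after the base has moved past \<open>x \<bullet> e\<close> to -1.\<close>

lemma abs_tubefn_le_outside:
  assumes "(pi + 1)\<^sup>2 \<le> x \<bullet> x - (x \<bullet> e)\<^sup>2"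
  shows "\<bar>tubefn e x\<bar> \<le> tube_bound"
proof (cases "x \<bullet> e \<le> -2")
  case False
  have q: "(Im z)\<^sup>2 + 1 \<le> x \<bullet> x - (x \<bullet> e)\<^sup>2" if "\<bar>Im z\<bar> \<le> pi" for z
  proof -
    have "(Im z)\<^sup>2 \<le> pi\<^sup>2" using that power_mono[of "\<bar>Im z\<bar>" pi 2] by simp
    also have "pi\<^sup>2 + 1 \<le> (pi + 1)\<^sup>2" using pi_gt_zero by (simp add: power2_eq_square algebra_simps)
    finally show ?thesis using assms by linarith
  qed
  define S where "S = {z. -pi \<le> Im z} \<inter> {z. Im z \<le> pi}"
  have slit: "sqdist e x z \<notin> \<real>\<^sub>\<le>\<^sub>0" if "z \<in> S" for z
    using sqdist_strip(2)[OF e, of z x] q[of z] that by (auto simp: S_def abs_le_iff)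
  have holo: "kern e x holomorphic_on S"
    unfolding kern_def by (intro holomorphic_on_sqdist_powr slit)
  have n1: "norm (kern e x z) \<le> 1" if "z \<in> S" for z
  proof -
    have 1: "1 \<le> norm (sqdist e x z)"
      using sqdist_strip(1)[OF e, of z x] q[of z] that by (auto simp: S_def abs_le_iff)
    have "norm (kern e x z) = norm (sqdist e x z) powr (1 - real DIM('a) / 2)"
      by (simp add: kern_def norm_powr_real_powr')
    also have "\<dots> \<le> 1 powr (1 - real DIM('a) / 2)"
      using 1 dim by (intro powr_mono2') auto
    finally show ?thesis by simp
  qed
  have lt: "-1 < x \<bullet> e + 1" using False by simp
  have shift: "strip_integral (x \<bullet> e + 1) (\<lambda>z. exp (exp z) * kern e x z) =
      strip_integral (-1) (\<lambda>z. exp (exp z) * kern e x z)"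
  proof (rule strip_integral_indep[OF lt _ holo])
    show "convex S" unfolding S_def
      by (intro convex_Int convex_halfspace_Im_le convex_halfspace_Im_ge)
    show "kern e x (Complex s (-pi)) = cnj (kern e x (Complex s pi))" for s
      using kern_cnj[OF slit, of "Complex s pi"] by (simp add: complex_cnj S_def)
    show "norm (kern e x (Complex s pi)) \<le> 1" for s by (rule n1) (simp add: S_def)
  qed (auto simp: S_def in_cbox_complex_iff)
  have c: "continuous_on T (\<lambda>t. kern e x (\<zeta> t))"
    if "continuous_on T \<zeta>" "\<And>t. t \<in> T \<Longrightarrow> \<zeta> t \<in> S" for T and \<zeta> :: "real \<Rightarrow> complex"
    by (rule continuous_on_compose2[OF holomorphic_on_imp_continuous_on[OF holo] that(1)])
      (use that(2) in auto)
  have "\<bar>strip_integral (-1) (\<lambda>z. exp (exp z) * kern e x z)\<bar> \<le> 2 * pi * exp (exp (-1)) + 2 * exp_exp_tail (-1)"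
    by (rule abs_strip_integral_le) (auto simp: S_def abs_le_iff intro!: c continuous_intros n1)
  then show ?thesis by (simp add: tube_bound_def tubefn_def shift)
qed (rule abs_tubefn_le_left)

lemma harmonic_strip_integral:
  "(\<lambda>x. strip_integral b (\<lambda>z. exp (exp z) * kern e x z)) harmonic_on {x. x \<bullet> e < b}"
proof -
  define a where "a = 1 - real DIM('a) / 2"
  let ?E = "\<lambda>x. \<integral>y. Re (exp (exp (Complex b y)) * sqdist e x (Complex b y) powr of_real a)
      \<partial>restrict_space lborel {-pi..pi}"
  \<comment> \<open>The coefficient \<open>- 2 * \<i>\<close> rewrites twice an imaginary part as
    the real part that \<open>harmonic_on_superposition\<close> expects.\<close>
  let ?T = "\<lambda>x. \<integral>s. Re ((- 2 * \<i> * exp (exp (Complex s pi))) * sqdist e x (Complex s pi) powr of_real a)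
      \<partial>restrict_space lborel {b..}"
  have E: "?E harmonic_on {x. x \<bullet> e < b}"
    unfolding a_def
  proof (rule harmonic_on_superposition[OF e])
    have "set_integrable lborel {-pi..pi}
        (\<lambda>y. norm (exp (exp (Complex b y))) * (1 + norm (Complex b y))\<^sup>2)"
      by (intro borel_integrable_atLeastAtMost' continuous_intros)
    then show "integrable (restrict_space lborel {-pi..pi})
        (\<lambda>y. norm (exp (exp (Complex b y))) * (1 + norm (Complex b y))\<^sup>2)"
      by (subst integrable_restrict_space) (auto simp: set_integrable_def)
  qed (use dim in \<open>auto intro!: continuous_intros\<close>)
  have T: "?T harmonic_on {x. x \<bullet> e < b}"
    unfolding a_def
  proof (rule harmonic_on_superposition[OF e])
    have "set_integrable lborel {b..} (\<lambda>s::real. exp (- exp s) * (1 + pi + \<bar>s\<bar>)\<^sup>2)"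
      by (rule set_integrable_exp_exp_quadratic) simp
    then have "set_integrable lborel {b..} (\<lambda>s::real. 2 * (exp (- exp s) * (1 + pi + \<bar>s\<bar>)\<^sup>2))" by simp
    then have "set_integrable lborel {b..}
        (\<lambda>s. norm (- 2 * \<i> * exp (exp (Complex s pi))) * (1 + norm (Complex s pi))\<^sup>2)"
    proof (rule set_integrable_bound)
      show "set_borel_measurable lborel {b..}
          (\<lambda>s. norm (- 2 * \<i> * exp (exp (Complex s pi))) * (1 + norm (Complex s pi))\<^sup>2)"
        unfolding set_borel_measurable_def measurable_lborel2
        by (intro borel_measurable_continuous_on_indicator continuous_intros) auto
      have "(1 + norm (Complex s pi))\<^sup>2 \<le> (1 + pi + \<bar>s\<bar>)\<^sup>2" for s
        using cmod_le[of "Complex s pi"] by (intro power_mono) auto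
      then show "AE s in lborel. s \<in> {b..} \<longrightarrow>
          norm (norm (- 2 * \<i> * exp (exp (Complex s pi))) * (1 + norm (Complex s pi))\<^sup>2)
          \<le> norm (2 * (exp (- exp s) * (1 + pi + \<bar>s\<bar>)\<^sup>2))"
        unfolding exp_exp_Complex_pi by (intro AE_I2 impI) (simp add: norm_mult)
    qed
    then show "integrable (restrict_space lborel {b..})
        (\<lambda>s. norm (- 2 * \<i> * exp (exp (Complex s pi))) * (1 + norm (Complex s pi))\<^sup>2)"
      by (subst integrable_restrict_space) (auto simp: set_integrable_def)
  qed (use dim in \<open>auto intro!: continuous_intros\<close>)
  have eq: "strip_integral b (\<lambda>z. exp (exp z) * kern e x z) = ?E x + ?T x" if "x \<bullet> e < b" for x
  proof -
    have c: "continuous_on S (\<lambda>t. kern e x (\<zeta> t))"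
      if "continuous_on S \<zeta>" "\<And>t. t \<in> S \<Longrightarrow> x \<bullet> e < Re (\<zeta> t)" for S and \<zeta> :: "real \<Rightarrow> complex"
      by (rule continuous_on_compose2[OF holomorphic_on_imp_continuous_on[OF holomorphic_kern_right] that(1)])
        (use that(2) in auto)
    have "set_integrable lborel {-pi..pi} (\<lambda>y. Re (exp (exp (Complex b y)) * kern e x (Complex b y)))"
      by (intro borel_integrable_atLeastAtMost' continuous_on_Re continuous_on_mult c)
        (use that in \<open>auto intro!: continuous_intros\<close>)
    from set_borel_integral_eq_integral(2)[OF this]
    have 1: "?E x = integral {-pi..pi} (\<lambda>y. Re (exp (exp (Complex b y)) * kern e x (Complex b y)))"
      by (subst integral_restrict_space) (simp_all add: set_lebesgue_integral_def kern_def a_def del: times_complex.sel)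
    have "set_integrable lborel {b..} (\<lambda>s. Im (exp (exp (Complex s pi)) * kern e x (Complex s pi)))"
    proof (rule tail_set_integrable)
      show "norm (kern e x (Complex s pi)) \<le> (b - x \<bullet> e) powr (2 * (1 - real DIM('a) / 2))" if "s \<ge> b" for s
        unfolding kern_def using that \<open>x \<bullet> e < b\<close> dim by (intro norm_sqdist_powr_le[OF e]) auto
    qed (use that in \<open>auto intro!: c continuous_intros\<close>)
    from set_borel_integral_eq_integral(2)[OF this]
    have 2: "(\<integral>s. Im (exp (exp (Complex s pi)) * kern e x (Complex s pi)) \<partial>restrict_space lborel {b..}) =
        integral {b..} (\<lambda>s. Im (exp (exp (Complex s pi)) * kern e x (Complex s pi)))"
      by (subst integral_restrict_space) (simp_all add: set_lebesgue_integral_def del: times_complex.sel)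
    have "Re (- 2 * \<i> * w * v) = 2 * Im (w * v)" for w v :: complex by simp
    then have "?T x = (\<integral>s. 2 * Im (exp (exp (Complex s pi)) * kern e x (Complex s pi)) \<partial>restrict_space lborel {b..})"
      unfolding kern_def a_def by (simp only:)
    also have "\<dots> = 2 * (\<integral>s. Im (exp (exp (Complex s pi)) * kern e x (Complex s pi)) \<partial>restrict_space lborel {b..})"
      by (rule integral_mult_right_zero)
    finally show ?thesis unfolding strip_integral_def 1 2 by simp
  qed
  show ?thesis
  \<comment> \<open>The splitting \<open>eq\<close> is known only inside the half space, so
    harmonicity of the sum is transferred by locality, with the half space itself as
    neighbourhood.\<close>
  proof (rule harmonic_on_locally)
    show "open {x. x \<bullet> e < b}" by (intro open_Collect_less continuous_intros)
    show "\<exists>T v. x \<in> T \<and> v harmonic_on T \<and>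
        (\<forall>y\<in>T. strip_integral b (\<lambda>z. exp (exp z) * kern e y z) = v y)" if "x \<in> {x. x \<bullet> e < b}" for x
      using harmonic_on_add[OF E T] eq that
      by (intro exI[of _ "{x. x \<bullet> e < b}"] exI[of _ "\<lambda>x. ?E x + ?T x"]) auto
  qed
qed

lemma harmonic_tubefn: "tubefn e harmonic_on UNIV"
proof (rule harmonic_on_locally)
  show "\<exists>T v. x \<in> T \<and> v harmonic_on T \<and> (\<forall>y\<in>T. tubefn e y = v y)" for x
    using harmonic_strip_integral[of "x \<bullet> e + 1"]
    by (intro exI[of _ "{y. y \<bullet> e < x \<bullet> e + 1}"] exI conjI) (auto intro: tubefn_eq_strip_integral)
qed simp

end

subsection \<open>Growth on the axis\<close>

text \<open>The prefactor is a Touchard polynomial in \<open>exp z\<close>. Storing its exponents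
  with multiplicity in a list makes the nonnegativity of the coefficients automatic.\<close>

lemma higher_deriv_exp_exp:
  "\<exists>ks. ks \<noteq> [] \<and> (deriv ^^ m) (\<lambda>z::complex. exp (exp z)) =
    (\<lambda>z. (\<Sum>k\<leftarrow>ks. exp (of_nat k * z)) * exp (exp z))"
proof (induction m)
  case 0
  show ?case by (intro exI[of _ "[0]"]) (simp add: fun_eq_iff)
next
  case (Suc m)
  then obtain ks where ks: "ks \<noteq> []" and
    eq: "(deriv ^^ m) (\<lambda>z::complex. exp (exp z)) = (\<lambda>z. (\<Sum>k\<leftarrow>ks. exp (of_nat k * z)) * exp (exp z))"
    by blast
  \<comment> \<open>Differentiating \<open>exp (k * z)\<close> yields \<open>k\<close> copies of
    itself, and differentiating \<open>exp (exp z)\<close> raises the exponent by one.\<close>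
  define ks' where "ks' = concat (map (\<lambda>k. replicate k k @ [Suc k]) ks)"
  have "((\<lambda>z. \<Sum>k\<leftarrow>js. exp (of_nat k * z)) has_field_derivative
      (\<Sum>k\<leftarrow>js. of_nat k * exp (of_nat k * z))) (at z)" for js and z :: complex
    by (induction js) (auto intro!: derivative_eq_intros)
  moreover have "((\<lambda>z. exp (exp z)) has_field_derivative exp z * exp (exp z)) (at z)" for z :: complex
    by (auto intro!: derivative_eq_intros)
  ultimately have d: "((\<lambda>z. (\<Sum>k\<leftarrow>ks. exp (of_nat k * z)) * exp (exp z)) has_field_derivative
      ((\<Sum>k\<leftarrow>ks. of_nat k * exp (of_nat k * z)) * exp (exp z) +
        exp z * exp (exp z) * (\<Sum>k\<leftarrow>ks. exp (of_nat k * z)))) (at z)" for z :: complex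
    by (rule DERIV_mult)
  have sum: "(\<Sum>k\<leftarrow>concat (map (\<lambda>k. replicate k k @ [Suc k]) js). exp (of_nat k * z)) =
      (\<Sum>k\<leftarrow>js. of_nat k * exp (of_nat k * z)) + exp z * (\<Sum>k\<leftarrow>js. exp (of_nat k * z))"
    for js and z :: complex
    by (induction js) (auto simp: sum_list_replicate algebra_simps exp_add)
  have "deriv (\<lambda>z. (\<Sum>k\<leftarrow>ks. exp (of_nat k * z)) * exp (exp z)) z =
      (\<Sum>k\<leftarrow>ks'. exp (of_nat k * z)) * exp (exp z)" for z :: complex
    unfolding DERIV_imp_deriv[OF d] ks'_def sum by (simp add: algebra_simps)
  moreover have "ks' \<noteq> []" using ks by (cases ks) (auto simp: ks'_def)
  ultimately show ?case
    by (intro exI[of _ ks']) (simp add: eq fun_eq_iff)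
qed

text \<open>At a real point \<open>X \<ge> 0\<close> every term of the nonempty prefactor is at
  least 1.\<close>

lemma higher_deriv_exp_exp_ge:
  assumes "X \<ge> 0"
  shows "exp (exp X) \<le> Re ((deriv ^^ m) (\<lambda>z. exp (exp z)) (of_real X))"
proof -
  obtain ks where ks: "ks \<noteq> []" and
    eq: "(deriv ^^ m) (\<lambda>z::complex. exp (exp z)) = (\<lambda>z. (\<Sum>k\<leftarrow>ks. exp (of_nat k * z)) * exp (exp z))"
    using higher_deriv_exp_exp by blast
  have r: "(\<Sum>k\<leftarrow>js. exp (of_nat k * complex_of_real X)) = of_real (\<Sum>k\<leftarrow>js. exp (real k * X))" for js
    by (induction js) (auto simp flip: exp_of_real)
  have nn: "(\<Sum>k\<leftarrow>js. exp (real k * X)) \<ge> 0" for js by (induction js) auto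
  have "(\<Sum>k\<leftarrow>ks. exp (real k * X)) \<ge> 1"
  proof (cases ks)
    case (Cons k ks')
    have "exp (real k * X) \<ge> 1" using assms by simp
    then show ?thesis using add_mono[OF _ nn[of ks'], of 1] by (simp add: Cons del: one_le_exp_iff)
  qed (use ks in simp)
  then have "1 * exp (exp X) \<le> (\<Sum>k\<leftarrow>ks. exp (real k * X)) * exp (exp X)"
    by (intro mult_right_mono) auto
  then show ?thesis unfolding eq r by (simp only: exp_of_real flip: of_real_mult) simp
qed

text \<open>In the right half plane the argument is below \<open>pi / 2\<close> in modulus, so
  \<open>Ln (w\<^sup>2) = 2 * Ln w\<close> and the half-integer power becomes an integer power, for
  odd dimension too.\<close>

lemma power2_powr_half:
  fixes w :: complex
  assumes "Re w > 0" "n \<ge> 2"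
  shows "w\<^sup>2 powr of_real (1 - real n / 2) = inverse (w ^ (n - 2))"
proof -
  have w: "w \<noteq> 0" using assms by auto
  have "\<bar>Im (Ln w)\<bar> < pi / 2" using Re_Ln_pos_lt[OF w] assms by simp
  then have "Ln (w\<^sup>2) = 2 * Ln w"
    using w by (intro Ln_unique) (auto simp: exp_double)
  then have "w\<^sup>2 powr of_real (1 - real n / 2) = exp (of_real (1 - real n / 2) * (2 * Ln w))"
    using w by (simp add: powr_def)
  also have "of_real (1 - real n / 2) * (2 * Ln w) = - (of_nat (n - 2) * Ln w)"
    using assms(2) by (simp add: of_nat_diff algebra_simps)
  also have "exp \<dots> = inverse (w ^ (n - 2))"
    by (simp only: exp_minus exp_of_nat_mult exp_Ln[OF w])
  finally show ?thesis .
qed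

text \<open>For a point of the axis the kernel has a pole of order \<open>DIM('a) - 2\<close> there.
  Moving the base from \<open>X + 1\<close> to -1 collects its residue, and the integral that
  remains is at most \<open>tube_bound\<close>.\<close>

lemma tubefn_axis_ge:
  fixes e :: "'a::euclidean_space"
  assumes e: "e \<in> Basis" and dim: "DIM('a) \<ge> 3" and X: "X \<ge> 0"
  shows "2 * pi / fact (DIM('a) - 3) * exp (exp X) - tube_bound \<le> tubefn e (X *\<^sub>R e)"
proof -
  define m where "m = DIM('a) - 3"
  define k where "k z = inverse ((z - of_real X) ^ Suc m)" for z :: complex
  define g where "g z = exp (exp z)" for z :: complex
  have m: "DIM('a) - 2 = Suc m" using dim by (simp add: m_def)
  have kern: "kern e (X *\<^sub>R e) z = k z" if "X < Re z" for z
  proof -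
    have "sqdist e (X *\<^sub>R e) z = (z - of_real X)\<^sup>2"
      using e by (simp add: sqdist_def power2_eq_square algebra_simps)
    then show ?thesis
      using power2_powr_half[of "z - of_real X" "DIM('a)"] that dim by (simp add: kern_def k_def m)
  qed
  have Xe: "X *\<^sub>R e \<bullet> e = X" using e by simp
  \<comment> \<open>The kernel is replaced by the meromorphic \<open>k\<close> before the contour
    moves: left of \<open>X\<close> the principal power may differ from \<open>k\<close> in
    sign.\<close>
  have eq: "tubefn e (X *\<^sub>R e) = strip_integral (X + 1) (\<lambda>z. g z * k z)"
    unfolding tubefn_def strip_integral_def Xe g_def
    by (intro arg_cong2[of _ _ _ _ "(+)"] arg_cong2[of _ _ _ _ "(*)"] integral_cong refl) (simp_all add: kern)
  have k_holo: "k holomorphic_on S - {of_real X}" for S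
    unfolding k_def by (intro holomorphic_intros) auto
  have F_holo: "(\<lambda>z. g z * k z) holomorphic_on S - {of_real X}" for S
    unfolding g_def by (intro holomorphic_intros k_holo)
  have k_cont: "continuous_on T (\<lambda>t. k (\<zeta> t))"
    if "continuous_on T \<zeta>" "\<And>t. t \<in> T \<Longrightarrow> \<zeta> t \<noteq> of_real X" for T and \<zeta> :: "real \<Rightarrow> complex"
    using that unfolding k_def by (intro continuous_intros) auto
  \<comment> \<open>The ray at height \<open>pi\<close> and, as \<open>X \<ge> 0\<close>, the line
    \<open>Re z = -1\<close> are at distance at least one from the pole.\<close>
  have k1: "norm (k z) \<le> 1" if "norm (z - of_real X) \<ge> 1" for z
    using that by (simp add: k_def norm_inverse norm_power inverse_le_1_iff one_le_power del: power_Suc)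
  have k_top: "norm (k (Complex s pi)) \<le> 1" for s
    using abs_Im_le_cmod[of "Complex s pi - of_real X"] pi_ge_two by (intro k1) simp
  have k_left: "norm (k (Complex (-1) y)) \<le> 1" for y
    using abs_Re_le_cmod[of "Complex (-1) y - of_real X"] X by (intro k1) simp
  have top: "Complex s pi \<noteq> of_real X" "Complex s (-pi) \<noteq> of_real X" for s
    by (auto simp: complex_eq_iff)
  let ?p = "rectpath (Complex (-1) (-pi)) (Complex (X + 1) pi)"
  have box: "of_real X \<in> box (Complex (-1) (-pi)) (Complex (X + 1) pi)"
    using X by (simp add: in_box_complex_iff)
  have img: "path_image ?p \<subseteq> UNIV - {of_real X}"
    using path_image_rectpath_inter_box[of "Complex (-1) (-pi)" "Complex (X + 1) pi"] box X by auto
  have "strip_integral (X + 1) (\<lambda>z. g z * k z) - strip_integral (-1) (\<lambda>z. g z * k z) =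
      Im (contour_integral ?p (\<lambda>z. g z * k z))"
  proof (rule strip_integral_diff)
    show "continuous_on (path_image ?p) (\<lambda>z. g z * k z)"
      by (rule continuous_on_subset[OF holomorphic_on_imp_continuous_on[OF F_holo] img])
    show "g (Complex s (-pi)) * k (Complex s (-pi)) = cnj (g (Complex s pi) * k (Complex s pi))" for s
    proof -
      have "Complex s (-pi) = cnj (Complex s pi)" by (simp add: complex_eq_iff)
      then show ?thesis by (simp only: g_def k_def exp_cnj complex_cnj_mult complex_cnj_inverse
            complex_cnj_power complex_cnj_diff complex_cnj_complex_of_real)
    qed
    show "(\<lambda>s. Im (g (Complex s pi) * k (Complex s pi))) integrable_on {X + 1..}"
      unfolding g_def
      by (intro set_borel_integral_eq_integral(1) tail_set_integrable[of _ _ 1] k_top k_cont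
          continuous_intros top)
  qed (use X in simp)
  also have "contour_integral ?p (\<lambda>z. g z * k z) =
      2 * pi * \<i> * (\<Sum>q\<in>{of_real X}. winding_number ?p q * residue (\<lambda>z. g z * k z) q)"
    by (rule Residue_theorem[OF open_UNIV _ _ F_holo _ _ img]) auto
  also have "\<dots> = 2 * pi * \<i> * residue (\<lambda>z. g z * k z) (of_real X)"
    by (simp add: winding_number_rectpath[OF box])
  also have "residue (\<lambda>z. g z * k z) (of_real X) = (deriv ^^ m) g (of_real X) / fact m"
  proof -
    have "(\<lambda>z. g z * k z) = (\<lambda>z. g z / (z - of_real X) ^ Suc m)"
      by (simp add: k_def fun_eq_iff divide_inverse)
    moreover have "g holomorphic_on UNIV"
      unfolding g_def by (intro holomorphic_intros)
    ultimately show ?thesis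
      using residue_holomorphic_over_power[of UNIV "of_real X" g m] by simp
  qed
  also have "Im (2 * pi * \<i> * ((deriv ^^ m) g (of_real X) / fact m)) =
      2 * pi / fact m * Re ((deriv ^^ m) g (of_real X))"
  proof -
    have "complex_of_real (2 * pi) * \<i> * (w / fact m) = of_real (2 * pi / fact m) * (\<i> * w)" for w
      by simp
    moreover have "Im (of_real r * (\<i> * w)) = r * Re w" for r w by simp
    ultimately show ?thesis by (simp only:)
  qed
  finally have "strip_integral (X + 1) (\<lambda>z. g z * k z) =
      strip_integral (-1) (\<lambda>z. g z * k z) + 2 * pi / fact m * Re ((deriv ^^ m) g (of_real X))"
    by simp
  moreover have "2 * pi / fact m * exp (exp X) \<le> 2 * pi / fact m * Re ((deriv ^^ m) g (of_real X))"
    unfolding g_def by (intro mult_left_mono higher_deriv_exp_exp_ge X) simp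
  moreover have "\<bar>strip_integral (-1) (\<lambda>z. g z * k z)\<bar> \<le> tube_bound"
    unfolding g_def tube_bound_def
    by (rule abs_strip_integral_le)
      (use X in \<open>auto intro!: k_cont k_top k_left continuous_intros top simp: complex_eq_iff\<close>)
  ultimately show ?thesis unfolding eq m_def[symmetric] by linarith
qed

subsection \<open>Rescaling\<close>

lemma inner_Basis_square_le:
  fixes y :: "'a::euclidean_space"
  assumes "e \<in> Basis" "i \<in> Basis" "i \<noteq> e"
  shows "(y \<bullet> i)\<^sup>2 \<le> y \<bullet> y - (y \<bullet> e)\<^sup>2"
proof -
  have "(\<Sum>j\<in>{i, e}. (y \<bullet> j)\<^sup>2) \<le> (\<Sum>j\<in>Basis. (y \<bullet> j)\<^sup>2)"
    by (rule sum_mono2) (use assms in auto)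
  also have "\<dots> = y \<bullet> y" by (subst euclidean_inner) (simp add: power2_eq_square)
  finally show ?thesis using assms by simp
qed

text \<open>The cross-section of the tube is enclosed in a cube instead of a ball, which costs only
  a constant depending on the dimension.\<close>

lemma measure_slab:
  fixes e :: "'a::euclidean_space"
  assumes e: "e \<in> Basis" and "l \<ge> 0" "w \<ge> 0" and S: "S \<in> sets lebesgue"
    and sub: "\<And>x. x \<in> S \<Longrightarrow> \<bar>x \<bullet> e\<bar> \<le> l"
      "\<And>x i. x \<in> S \<Longrightarrow> i \<in> Basis \<Longrightarrow> i \<noteq> e \<Longrightarrow> \<bar>x \<bullet> i\<bar> \<le> w"
  shows "measure lebesgue S \<le> 2 * l * (2 * w) ^ (DIM('a) - 1)"
proof -
  define v :: 'a where "v = (\<Sum>i\<in>Basis. (if i = e then l else w) *\<^sub>R i)"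
  have v: "v \<bullet> i = (if i = e then l else w)" if "i \<in> Basis" for i
    using that by (simp add: v_def)
  have "S \<subseteq> cbox (-v) v"
    using sub v by (fastforce simp: mem_box abs_le_iff)
  then have "measure lebesgue S \<le> measure lebesgue (cbox (-v) v)"
    by (rule measure_mono_fmeasurable[OF _ S]) simp
  also have "\<dots> = (\<Prod>i\<in>Basis. 2 * (v \<bullet> i))"
    using v assms by (subst measure_completion) (auto simp: content_cbox_if box_eq_empty
        intro!: prod.cong split: if_splits)
  also have "\<dots> = 2 * l * (\<Prod>i\<in>Basis - {e}. 2 * (v \<bullet> i))"
    using e by (subst prod.remove[of _ e]) (simp_all add: v)
  also have "(\<Prod>i\<in>Basis - {e}. 2 * (v \<bullet> i)) = (\<Prod>i\<in>(Basis - {e}). 2 * w)"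
    by (rule prod.cong) (auto simp: v)
  also have "\<dots> = (2 * w) ^ (DIM('a) - 1)" using e by simp
  finally show ?thesis .
qed

text \<open>Scaling by \<open>R\<close> shrinks the tube to radius \<open>(pi + 1) / R\<close>,
  while \<open>ln (1 + doubling_index (u R))\<close> is at most \<open>2 * R\<close>; so
  \<open>1 / R\<close> can be traded for the logarithm.\<close>

theorem thin_positivity_family:
  assumes dim: "DIM('a::euclidean_space) \<ge> 3"
  shows "\<exists>C>0. \<exists>R\<^sub>0>0. \<exists>u :: real \<Rightarrow> 'a \<Rightarrow> real.
    (\<forall>R\<ge>R\<^sub>0. u R harmonic_on UNIV \<and> (\<exists>x. u R x \<noteq> 0) \<and> u R 0 = 0) \<and>
    filterlim (\<lambda>R. doubling_index (u R)) at_top at_top \<and>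
    (\<forall>R\<ge>R\<^sub>0. measure lebesgue ({x. u R x > 0} \<inter> ball 0 (1/2))
      \<le> C * ln (1 + doubling_index (u R)) powi (1 - int DIM('a)))"
proof -
  obtain e :: 'a where e: "e \<in> Basis" using nonempty_Basis by blast
  define c where "c = 2 * pi / fact (DIM('a) - 3)"
  define T where "T = tube_bound"
  define V where "V = tubefn e"
  have c: "c > 0" by (simp add: c_def)
  have "((-2) *\<^sub>R e) \<bullet> e = -2" using e by simp
  then have T: "T \<ge> 0"
    using abs_tubefn_le_left[OF e dim, of "(-2) *\<^sub>R e"] abs_ge_zero unfolding T_def by (metis order_refl order_trans)
  \<comment> \<open>Since \<open>exp (exp P) \<ge> P\<close>, the axis bound gives
    \<open>V p \<ge> c * P - T = T\<close>: the value at \<open>p\<close> dominates the bound off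
    the tube.\<close>
  define P where "P = 2 * T / c"
  have P: "P \<ge> 0" using T c by (simp add: P_def)
  define p where "p = P *\<^sub>R e"
  have axis: "c * exp (exp X) - T \<le> V (X *\<^sub>R e)" if "X \<ge> 0" for X
    using tubefn_axis_ge[OF e dim that] by (simp add: c_def T_def V_def)
  have "P \<le> exp (exp P)"
    using exp_ge_add_one_self[of P] exp_ge_add_one_self[of "exp P"] by linarith
  then have "c * P \<le> c * exp (exp P)" using c by (intro mult_left_mono) auto
  moreover have "c * P = 2 * T" using c by (simp add: P_def)
  ultimately have Vp: "V p \<ge> T" using axis[OF P] by (simp add: p_def)
  define K where "K = T + V p"
  define u where "u R x = V (R *\<^sub>R x + p) - V p" for R x
  have harm: "u R harmonic_on UNIV" for R
    unfolding u_def[abs_def] V_def by (intro harmonic_on_affine harmonic_tubefn e dim)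
  have upper: "\<bar>u R x\<bar> \<le> K + 2 * pi * exp (exp (R * norm x + P + 1))" if "R > 0" for R x
  proof -
    have "x \<bullet> e \<le> norm x" using Basis_le_norm[OF e, of x] by linarith
    then have "R * (x \<bullet> e) \<le> R * norm x" using that by simp
    then have "(R *\<^sub>R x + p) \<bullet> e + 1 \<le> R * norm x + P + 1"
      using e by (simp add: inner_add_left p_def)
    then have "2 * pi * exp (exp ((R *\<^sub>R x + p) \<bullet> e + 1)) \<le> 2 * pi * exp (exp (R * norm x + P + 1))"
      by simp
    moreover have "\<bar>V (R *\<^sub>R x + p)\<bar> \<le> T + 2 * pi * exp (exp ((R *\<^sub>R x + p) \<bullet> e + 1))"
      using abs_tubefn_le[OF e dim] by (simp add: V_def T_def)
    ultimately show ?thesis using Vp T unfolding u_def K_def by linarith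
  qed
  have lower: "c * exp (exp (R * r + P)) - K \<le> u R (r *\<^sub>R e)" if "R > 0" "r \<ge> 0" for R r
  proof -
    have "R *\<^sub>R r *\<^sub>R e + p = (R * r + P) *\<^sub>R e" by (simp add: p_def scaleR_add_left)
    then show ?thesis using axis[of "R * r + P"] that P by (simp add: u_def K_def)
  qed
  have bdd: "bdd_above ((\<lambda>x. \<bar>u R x\<bar>) ` ball 0 \<rho>)" if "R > 0" for R \<rho>
  proof (rule bdd_aboveI2)
    fix x :: 'a assume "x \<in> ball 0 \<rho>"
    then have "R * norm x \<le> R * \<rho>" using that by simp
    then have "2 * pi * exp (exp (R * norm x + P + 1)) \<le> 2 * pi * exp (exp (R * \<rho> + P + 1))" by simp
    then show "\<bar>u R x\<bar> \<le> K + 2 * pi * exp (exp (R * \<rho> + P + 1))" using upper[OF that, of x] by linarith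
  qed
  have sup_le: "(SUP x\<in>ball 0 \<rho>. \<bar>u R x\<bar>) \<le> K + 2 * pi * exp (exp (R * \<rho> + P + 1))"
    if "R > 0" "\<rho> > 0" for R \<rho>
  proof (rule cSUP_least)
    fix x :: 'a assume "x \<in> ball 0 \<rho>"
    then have "R * norm x \<le> R * \<rho>" using that by simp
    then have "2 * pi * exp (exp (R * norm x + P + 1)) \<le> 2 * pi * exp (exp (R * \<rho> + P + 1))" by simp
    then show "\<bar>u R x\<bar> \<le> K + 2 * pi * exp (exp (R * \<rho> + P + 1))" using upper[OF that(1), of x] by linarith
  qed (use that in auto)
  have sup_ge: "c * exp (exp (R * r + P)) - K \<le> (SUP x\<in>ball 0 \<rho>. \<bar>u R x\<bar>)"
    if "R > 0" "0 \<le> r" "r < \<rho>" for R r \<rho>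
  proof -
    have "r *\<^sub>R e \<in> ball 0 \<rho>" using that e by simp
    then have "\<bar>u R (r *\<^sub>R e)\<bar> \<le> (SUP x\<in>ball 0 \<rho>. \<bar>u R x\<bar>)"
      using bdd[OF that(1)] by (intro cSUP_upper)
    then show ?thesis using lower[OF that(1,2)] by linarith
  qed
  \<comment> \<open>\<open>L\<close> and \<open>A\<close> bound the suprema over the balls of radius
    1/2 and 1 from below, through axis points at distance 1/4 and 3/4; \<open>B\<close> and
    \<open>U\<close> bound them from above. As 3/4 exceeds 1/2, \<open>A R / B R\<close> tends to
    infinity.\<close>
  define L where "L R = c * exp (exp (R * (1/4) + P)) - K" for R
  define A where "A R = c * exp (exp (R * (3/4) + P)) - K" for R
  define B where "B R = K + 2 * pi * exp (exp (R * (1/2) + P + 1))" for R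
  define U where "U R = K + 2 * pi * exp (exp (R * 1 + P + 1))" for R
  have "eventually (\<lambda>R. L R \<ge> 1) at_top" using c unfolding L_def by real_asymp
  moreover have "eventually (\<lambda>R. A R \<ge> 1) at_top" using c unfolding A_def by real_asymp
  moreover have N0: "filterlim (\<lambda>R. log 2 (A R / B R)) at_top at_top"
    using c unfolding A_def B_def by real_asymp
  \<comment> \<open>Two logarithms of \<open>U R\<close> leave \<open>R\<close> plus a bounded term;
    the factor 2 absorbs the latter.\<close>
  moreover have "eventually (\<lambda>R. ln (1 + log 2 (U R)) \<le> 2 * R) at_top"
    unfolding U_def by real_asymp
  ultimately have "eventually (\<lambda>R. L R \<ge> 1 \<and> A R \<ge> 1 \<and> log 2 (A R / B R) \<ge> 1 \<and>
      ln (1 + log 2 (U R)) \<le> 2 * R) at_top"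
    by (auto simp: filterlim_at_top intro!: eventually_conj)
  then obtain R1 where R1: "\<And>R. R \<ge> R1 \<Longrightarrow> L R \<ge> 1 \<and> A R \<ge> 1 \<and> log 2 (A R / B R) \<ge> 1 \<and>
      ln (1 + log 2 (U R)) \<le> 2 * R"
    unfolding eventually_at_top_linorder by blast
  define R0 where "R0 = max R1 1"
  have index: "log 2 (A R / B R) \<le> doubling_index (u R)" "1 \<le> doubling_index (u R)"
      "ln (1 + doubling_index (u R)) \<le> 2 * R" "1 \<le> (SUP x\<in>ball 0 (1/2). \<bar>u R x\<bar>)" if "R \<ge> R0" for R
  proof -
    have R: "R > 0" "R \<ge> R1" using that by (auto simp: R0_def)
    note * = R1[OF R(2)]
    define M where "M = (SUP x\<in>ball 0 1. \<bar>u R x\<bar>)"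
    define m where "m = (SUP x\<in>ball 0 (1/2). \<bar>u R x\<bar>)"
    have M: "A R \<le> M" "M \<le> U R"
      using sup_ge[OF R(1), of "3/4" 1] sup_le[OF R(1), of 1] by (simp_all add: A_def U_def M_def)
    have m: "L R \<le> m" "m \<le> B R"
      using sup_ge[OF R(1), of "1/4" "1/2"] sup_le[OF R(1), of "1/2"] by (simp_all add: L_def B_def m_def)
    have di: "doubling_index (u R) = log 2 (M / m)" by (simp add: doubling_index_def M_def m_def)
    have "A R / B R \<le> M / m" using M m * by (intro frac_le) auto
    moreover have "A R / B R > 0" using M m * by (intro divide_pos_pos) auto
    ultimately show 1: "log 2 (A R / B R) \<le> doubling_index (u R)" unfolding di by simp
    then show 2: "1 \<le> doubling_index (u R)" using * by linarith
    \<comment> \<open>The denominator is at least \<open>L R \<ge> 1\<close>, so the upper bound for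
      the numerator alone controls the quotient.\<close>
    have "M / m \<le> M" using M m * by (simp add: divide_le_eq mult_le_cancel_left1)
    then have "M / m \<le> U R" using M by linarith
    moreover have "M / m > 0" using M m * by (intro divide_pos_pos) auto
    ultimately have "log 2 (M / m) \<le> log 2 (U R)" by (intro log_mono) auto
    then have "ln (1 + doubling_index (u R)) \<le> ln (1 + log 2 (U R))"
      using 2 unfolding di by (intro ln_mono) auto
    then show "ln (1 + doubling_index (u R)) \<le> 2 * R" using * by linarith
    show "1 \<le> (SUP x\<in>ball 0 (1/2). \<bar>u R x\<bar>)" using m * unfolding m_def by linarith
  qed
  have meas: "measure lebesgue ({x. u R x > 0} \<inter> ball 0 (1/2))
      \<le> (4 * (pi + 1)) ^ (DIM('a) - 1) * ln (1 + doubling_index (u R)) powi (1 - int DIM('a))"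
    if "R \<ge> R0" for R
  proof -
    have R: "R > 0" using that by (auto simp: R0_def)
    have "open ({x. u R x > 0} \<inter> ball 0 (1/2))"
      using harmonic_on_continuous_on[OF harm[of R]]
      by (intro open_Int open_Collect_less continuous_intros open_ball) auto
    then have "measure lebesgue ({x. u R x > 0} \<inter> ball 0 (1/2)) \<le> 2 * (1/2) * (2 * ((pi + 1) / R)) ^ (DIM('a) - 1)"
    proof (intro measure_slab[OF e])
      fix x assume x: "x \<in> {x. u R x > 0} \<inter> ball 0 (1/2)"
      show "\<bar>x \<bullet> e\<bar> \<le> 1/2" using Basis_le_norm[OF e, of x] x by auto
      fix i :: 'a assume i: "i \<in> Basis" "i \<noteq> e"
      let ?y = "R *\<^sub>R x + p"
      \<comment> \<open>Off the tube \<open>V\<close> is at most \<open>T \<le> V p\<close>, so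
        \<open>u R\<close> could not be positive at \<open>x\<close>.\<close>
      have "\<not> (pi + 1)\<^sup>2 \<le> ?y \<bullet> ?y - (?y \<bullet> e)\<^sup>2"
        using abs_tubefn_le_outside[OF e dim, of ?y] x Vp by (auto simp: u_def V_def T_def)
      then have "(?y \<bullet> i)\<^sup>2 \<le> (pi + 1)\<^sup>2" using inner_Basis_square_le[OF e i, of ?y] by linarith
      then have "\<bar>?y \<bullet> i\<bar> \<le> pi + 1" using pi_gt_zero by (simp add: abs_le_square_iff[symmetric])
      moreover have "?y \<bullet> i = R * (x \<bullet> i)" using i e by (simp add: inner_add_left p_def inner_Basis)
      ultimately show "\<bar>x \<bullet> i\<bar> \<le> (pi + 1) / R" using R by (simp add: abs_mult field_simps)
    qed (use R pi_gt_zero in \<open>auto intro: lmeasurable_open\<close>)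
    \<comment> \<open>The factor \<open>2 * R\<close> is split off because it is the quantity that
      bounds the logarithm of the doubling index.\<close>
    also have "\<dots> = (4 * (pi + 1)) ^ (DIM('a) - 1) * inverse ((2 * R) ^ (DIM('a) - 1))"
    proof -
      have "2 * ((pi + 1) / R) = 4 * (pi + 1) * inverse (2 * R)" using R by (simp add: field_simps)
      then show ?thesis by (simp only: power_mult_distrib[of "4 * (pi + 1)"] power_inverse)
    qed
    also have "\<dots> \<le> (4 * (pi + 1)) ^ (DIM('a) - 1) * inverse (ln (1 + doubling_index (u R)) ^ (DIM('a) - 1))"
      using index(2,3)[OF that] pi_gt_zero
      by (intro mult_left_mono le_imp_inverse_le power_mono zero_less_power ln_gt_zero) auto
    also have "inverse (ln (1 + doubling_index (u R)) ^ (DIM('a) - 1)) =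
        ln (1 + doubling_index (u R)) powi (1 - int DIM('a))"
    proof -
      have "1 - int DIM('a) = - int (DIM('a) - 1)" using dim by simp
      then show ?thesis by (simp only: power_int_minus power_int_of_nat)
    qed
    finally show ?thesis .
  qed
  have nz: "\<exists>x. u R x \<noteq> 0" if "R \<ge> R0" for R
  proof (rule ccontr)
    assume "\<nexists>x. u R x \<noteq> 0"
    then show False using index(4)[OF that] by simp
  qed
  have lim: "filterlim (\<lambda>R. doubling_index (u R)) at_top at_top"
    using N0 by (rule filterlim_at_top_mono)
      (use index(1) in \<open>auto simp: eventually_at_top_linorder\<close>)
  show ?thesis
    by (rule exI[of _ "(4 * (pi + 1)) ^ (DIM('a) - 1)"], intro conjI exI[of _ R0] exI[of _ u])
      (use harm nz lim meas pi_gt_zero in \<open>auto simp: u_def R0_def add_pos_pos\<close>)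
qed

theorem proposition6p6:
  assumes "CARD('n::finite) \<ge> 3"
  shows "\<exists>C>0. \<exists>R\<^sub>0>0. \<exists>u :: real \<Rightarrow> real ^ 'n \<Rightarrow> real.
    (\<forall>R\<ge>R\<^sub>0. u R harmonic_on UNIV \<and> (\<exists>x. u R x \<noteq> 0) \<and> u R 0 = 0) \<and>
    filterlim (\<lambda>R. doubling_index (u R)) at_top at_top \<and>
    (\<forall>R\<ge>R\<^sub>0. measure lebesgue ({x. u R x > 0} \<inter> ball 0 (1/2))
      \<le> C * ln (1 + doubling_index (u R)) powi (1 - int CARD('n)))"
  using thin_positivity_family[where 'a = "real ^ 'n"] assms by simp

end
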